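(* Let $(X,T,\sigma)$ be a minimal dynamical system ($T$ an abelian group acting by homeomorphisms $\sigma^t$ on a compact metrisable space $X$) with an equicontinuous factor $\pi:(X,\sigma)\to(Y,\delta)$ such that $E^{fib}=\mathrm{Cov}$. Let $e$ be a minimal idempotent of the Ellis semigroup $E=E(X)$. Then the structure group $\mathcal G^{fib}=eE^{fib}e$ of the kernel $\mathcal M^{fib}(X)$ of $E^{fib}$ is isomorphic to $G_\pi^{Y/T}$. Moreover, the structure group $\mathcal G=eEe$ of the kernel $\mathcal M(X)$ of $E$ is a semidirect product $\mathcal G=\mathcal G^{fib}\rtimes Y$. Furthermore, if $M[\mathcal G^{fib};I,\Lambda;A]$ is the normalised Rees matrix form of $\mathcal M^{fib}(X)$ with respect to $e$, then $\mathcal M(X)$ is algebraically isomorphic to $M[\mathcal G^{fib}\rtimes Y;I,\Lambda;A]$.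
   Context: $E=E(X)$ is the closure of $\{\sigma^t:t\in T\}$ in $X^X$ (pointwise convergence), a semigroup under composition. $(Y,\delta)$ is equicontinuous if $\{\delta^t\}$ is an equicontinuous family; being minimal, $Y$ carries (after choosing an identity $0\in Y$) a topological abelian group structure with $\delta^t(y)=y+\delta^t(0)$. The factor map induces the surjective semigroup morphism $\tilde\pi:E\to Y$, $\tilde\pi(f)=\pi(f(x))$ for any $x\in\pi^{-1}(0)$. $E^{fib}=\tilde\pi^{-1}(0)$ is the subsemigroup of those $f\in E$ preserving every fibre $\pi^{-1}(y)$, and $E^{fib}_y$ denotes the set of restrictions of its elements to $\pi^{-1}(y)$. An $f\in E^{fib}$ is identified with the function $\tilde f: y\mapsto f|_{\pi^{-1}(y)}\in E^{fib}_y$. Put $$\mathrm{Cov}=\{\tilde f\in\prod_{y\in Y}E^{fib}_y : \tilde f(\delta^t(y))=\sigma^t\tilde f(y)\sigma^{-t}\ \forall y\in Y, t\in T\},$$ so that $E^{fib}\subset\mathrm{Cov}$. The kernel of a semigroup is its smallest two-sided ideal. An idempotent $e$ is minimal if it is minimal for the order $p\le q\iff p=pq=qp$; then $eEe$ is a group. The groups $eE^{fib}_ye$ (restrictions of elements of $eE^{fib}e$ to $e\pi^{-1}(y)$), $y\in Y$, are all isomorphic; $G_\pi$ denotes this group, called the structure group of the factor. $Y/T$ is the set of $T$-orbits in $Y$. Matrix semigroup: for a group $G$, sets $I,\Lambda$ and a matrix $A=(a_{\lambda i})_{\lambda\in\Lambda,i\in I}$ over $G$, $M[G;I,\Lambda;A]$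 is $I\times G\times\Lambda$ with product $(i,g,\lambda)(j,h,\mu)=(i,ga_{\lambda j}h,\mu)$. Normalised Rees matrix form of a completely simple semigroup $S$ (one without proper two-sided ideals and having a minimal idempotent) with respect to an idempotent $e$: $I$ and $\Lambda$ index the minimal right ideals $R_i$ and minimal left ideals $L_\lambda$ of $S$, $e\in R_{i_0}\cap L_{\lambda_0}$, $G=R_{i_0}\cap L_{\lambda_0}=eSe$, $r_i$ is the idempotent of $R_i\cap L_{\lambda_0}$, $q_\lambda$ the idempotent of $R_{i_0}\cap L_\lambda$, $a_{\lambda i}=q_\lambda r_i$; then $(i,g,\lambda)\mapsto r_igq_\lambda$ is an isomorphism $M[G;I,\Lambda;A]\to S$. The structure group of $S$ is $G$. The kernels $\mathcal M^{fib}(X)$ and $\mathcal M(X)$ are completely simple. In $M[\mathcal G^{fib}\rtimes Y;I,\Lambda;A]$ the entries of $A$ are viewed in $\mathcal G^{fib}\subset\mathcal G^{fib}\rtimes Y$.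
   Formalization: The semidirect product and final Rees form are proved assuming that σ^t = id whenever δ^t = id; without this they can fail (T=Z, X=Z/4, Y=Z/2). Unconditionally: G^fib ≅ G_π^{Y/T}, G → Y onto with kernel G^fib, and M(X) ≅ M[G;I,Λ;A]. *)

theory Defs
  imports "HOL-Analysis.Analysis" "HOL-Algebra.Algebra"
begin

section \<open>Semigroups\<close>

text \<open>
  Semigroups are HOL-Algebra monoid records of which only the carrier and the multiplication are
  used; in particular \<open>S\<lparr>carrier := K\<rparr>\<close> is a subsemigroup whose unit field is irrelevant.
  The library's \<^const>\<open>hom\<close>, \<^const>\<open>Group.iso\<close> and \<open>\<cong>\<close> do not mention the unit either.
\<close>

definition left_ideal :: "('a, 'b) monoid_scheme \<Rightarrow> 'a set \<Rightarrow> bool" where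
  "left_ideal S L \<longleftrightarrow> L \<noteq> {} \<and> L \<subseteq> carrier S \<and> (\<forall>s\<in>carrier S. \<forall>a\<in>L. s \<otimes>\<^bsub>S\<^esub> a \<in> L)"

definition right_ideal :: "('a, 'b) monoid_scheme \<Rightarrow> 'a set \<Rightarrow> bool" where
  "right_ideal S R \<longleftrightarrow> R \<noteq> {} \<and> R \<subseteq> carrier S \<and> (\<forall>s\<in>carrier S. \<forall>a\<in>R. a \<otimes>\<^bsub>S\<^esub> s \<in> R)"

definition min_left_ideals :: "('a, 'b) monoid_scheme \<Rightarrow> 'a set set" where
  "min_left_ideals S = {L. left_ideal S L \<and> (\<forall>L'. left_ideal S L' \<and> L' \<subseteq> L \<longrightarrow> L' = L)}"

definition min_right_ideals :: "('a, 'b) monoid_scheme \<Rightarrow> 'a set set" where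
  "min_right_ideals S = {R. right_ideal S R \<and> (\<forall>R'. right_ideal S R' \<and> R' \<subseteq> R \<longrightarrow> R' = R)}"

definition semigroup_kernel :: "('a, 'b) monoid_scheme \<Rightarrow> 'a set" where
  "semigroup_kernel S = (LEAST K. left_ideal S K \<and> right_ideal S K)"

definition idempotent_in :: "('a, 'b) monoid_scheme \<Rightarrow> 'a \<Rightarrow> bool" where
  "idempotent_in S p \<longleftrightarrow> p \<in> carrier S \<and> p \<otimes>\<^bsub>S\<^esub> p = p"

definition minimal_idempotent :: "('a, 'b) monoid_scheme \<Rightarrow> 'a \<Rightarrow> bool" where
  "minimal_idempotent S e \<longleftrightarrow>
     idempotent_in S e \<and>
     (\<forall>p. idempotent_in S p \<and> p = p \<otimes>\<^bsub>S\<^esub> e \<and> p = e \<otimes>\<^bsub>S\<^esub> p \<longrightarrow> p = e)"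

text \<open>The local submonoid \<open>eSe\<close>, with unit \<open>e\<close>.\<close>

definition local_group :: "('a, 'b) monoid_scheme \<Rightarrow> 'a \<Rightarrow> 'a monoid" where
  "local_group S e =
     \<lparr>carrier = {e \<otimes>\<^bsub>S\<^esub> s \<otimes>\<^bsub>S\<^esub> e | s. s \<in> carrier S}, mult = mult S, one = e\<rparr>"

definition rees_semigroup ::
  "('g, 'b) monoid_scheme \<Rightarrow> 'i set \<Rightarrow> 'l set \<Rightarrow> ('l \<Rightarrow> 'i \<Rightarrow> 'g) \<Rightarrow> ('i \<times> 'g \<times> 'l) monoid" where
  "rees_semigroup G I \<Lambda> A =
     \<lparr>carrier = I \<times> carrier G \<times> \<Lambda>,
      mult = (\<lambda>(i, g, l) (j, h, m). (i, g \<otimes>\<^bsub>G\<^esub> A l j \<otimes>\<^bsub>G\<^esub> h, m)),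
      one = undefined\<rparr>"

text \<open>
  The sandwich matrix of the normalised Rees matrix form of a completely simple semigroup \<open>S\<close> with
  respect to an idempotent \<open>e\<close>. The index sets are \<open>min_right_ideals S\<close> and \<open>min_left_ideals S\<close>
  themselves, and \<open>R\<^sub>0\<close>, \<open>L\<^sub>0\<close> are the ones containing \<open>e\<close>.
\<close>

definition rees_matrix :: "('a, 'b) monoid_scheme \<Rightarrow> 'a \<Rightarrow> 'a set \<Rightarrow> 'a set \<Rightarrow> 'a" where
  "rees_matrix S e L R =
     (let R0 = (THE R'. R' \<in> min_right_ideals S \<and> e \<in> R');
          L0 = (THE L'. L' \<in> min_left_ideals S \<and> e \<in> L');
          q = (THE p. idempotent_in S p \<and> p \<in> R0 \<inter> L);
          r = (THE p. idempotent_in S p \<and> p \<in> R \<inter> L0)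
      in q \<otimes>\<^bsub>S\<^esub> r)"

definition semidirect_product ::
  "('n, 'b) monoid_scheme \<Rightarrow> ('q, 'c) monoid_scheme \<Rightarrow> ('q \<Rightarrow> 'n \<Rightarrow> 'n) \<Rightarrow> ('n \<times> 'q) monoid" where
  "semidirect_product N Q \<phi> =
     \<lparr>carrier = carrier N \<times> carrier Q,
      mult = (\<lambda>(n, q) (n', q'). (n \<otimes>\<^bsub>N\<^esub> \<phi> q n', q \<otimes>\<^bsub>Q\<^esub> q')),
      one = (\<one>\<^bsub>N\<^esub>, \<one>\<^bsub>Q\<^esub>)\<rparr>"


section \<open>Dynamical systems\<close>

text \<open>
  The phase space is a whole metric type, assumed compact. Continuity of each map of the action
  suffices for it to be a homeomorphism, since the action is by a group.
\<close>

definition dynamical_system :: "('t, 'b) monoid_scheme \<Rightarrow> ('t \<Rightarrow> 'x \<Rightarrow> 'x::metric_space) \<Rightarrow> bool" where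
  "dynamical_system T \<sigma> \<longleftrightarrow>
     comm_group T \<and> compact (UNIV :: 'x set) \<and> group_action T UNIV \<sigma> \<and>
     (\<forall>t\<in>carrier T. continuous_on UNIV (\<sigma> t))"

definition minimal_system :: "('t, 'b) monoid_scheme \<Rightarrow> ('t \<Rightarrow> 'x \<Rightarrow> 'x::metric_space) \<Rightarrow> bool" where
  "minimal_system T \<sigma> \<longleftrightarrow> dynamical_system T \<sigma> \<and> (\<forall>x. closure (orbit T \<sigma> x) = UNIV)"

definition equicontinuous_system :: "('t, 'b) monoid_scheme \<Rightarrow> ('t \<Rightarrow> 'y \<Rightarrow> 'y::metric_space) \<Rightarrow> bool" where
  "equicontinuous_system T \<delta> \<longleftrightarrow>
     dynamical_system T \<delta> \<and>
     (\<forall>y. \<forall>\<epsilon>>0. \<exists>d>0. \<forall>z. dist z y < d \<longrightarrow> (\<forall>t\<in>carrier T. dist (\<delta> t z) (\<delta> t y) < \<epsilon>))"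

definition factor_map ::
  "('t, 'b) monoid_scheme \<Rightarrow> ('t \<Rightarrow> 'x \<Rightarrow> 'x::metric_space) \<Rightarrow> ('t \<Rightarrow> 'y \<Rightarrow> 'y::metric_space) \<Rightarrow>
   ('x \<Rightarrow> 'y) \<Rightarrow> bool" where
  "factor_map T \<sigma> \<delta> p \<longleftrightarrow>
     continuous_on UNIV p \<and> surj p \<and> (\<forall>t\<in>carrier T. \<forall>x. p (\<sigma> t x) = \<delta> t (p x))"

text \<open>
  For a minimal equicontinuous system \<open>(Y, \<delta>)\<close> and a chosen identity \<open>y0\<close> there is exactly one
  multiplication as described below: it is prescribed on pairs with one entry in the dense orbit
  of \<open>y0\<close>.
\<close>

definition factor_group :: "('t, 'b) monoid_scheme \<Rightarrow> ('t \<Rightarrow> 'y \<Rightarrow> 'y::metric_space) \<Rightarrow> 'y \<Rightarrow> 'y monoid" where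
  "factor_group T \<delta> y0 =
     \<lparr>carrier = UNIV,
      mult = (THE m. let Q = \<lparr>carrier = UNIV, mult = m, one = y0\<rparr> in
                comm_group Q \<and>
                continuous_on UNIV (\<lambda>(y, z). m y z) \<and>
                continuous_on UNIV (\<lambda>y. inv\<^bsub>Q\<^esub> y) \<and>
                (\<forall>t\<in>carrier T. \<forall>y. \<delta> t y = m y (\<delta> t y0))),
      one = y0\<rparr>"


section \<open>The Ellis semigroup and its fibre-preserving part\<close>

text \<open>The closure is taken in the product topology on \<^typ>\<open>'x \<Rightarrow> 'x\<close>.\<close>

definition ellis :: "('t, 'b) monoid_scheme \<Rightarrow> ('t \<Rightarrow> 'x \<Rightarrow> 'x::metric_space) \<Rightarrow> ('x \<Rightarrow> 'x) monoid" where
  "ellis T \<sigma> = \<lparr>carrier = closure (\<sigma> ` carrier T), mult = (\<circ>), one = id\<rparr>"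

text \<open>For \<open>f\<close> in the Ellis semigroup the value does not depend on the chosen point over \<open>y0\<close>.\<close>

definition induced :: "('x \<Rightarrow> 'y) \<Rightarrow> 'y \<Rightarrow> ('x \<Rightarrow> 'x) \<Rightarrow> 'y" where
  "induced p y0 f = p (f (SOME x. p x = y0))"

definition ellis_fib ::
  "('t, 'b) monoid_scheme \<Rightarrow> ('t \<Rightarrow> 'x \<Rightarrow> 'x::metric_space) \<Rightarrow> ('x \<Rightarrow> 'y) \<Rightarrow> 'y \<Rightarrow> ('x \<Rightarrow> 'x) monoid" where
  "ellis_fib T \<sigma> p y0 = (ellis T \<sigma>)\<lparr>carrier := {f \<in> carrier (ellis T \<sigma>). induced p y0 f = y0}\<rparr>"

definition fibre_restrictions :: "('x \<Rightarrow> 'y) \<Rightarrow> ('x \<Rightarrow> 'x) \<Rightarrow> 'y \<Rightarrow> 'x \<Rightarrow> 'x" where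
  "fibre_restrictions p f = (\<lambda>y. restrict f (p -` {y}))"

definition Cov ::
  "('t, 'b) monoid_scheme \<Rightarrow> ('t \<Rightarrow> 'x \<Rightarrow> 'x::metric_space) \<Rightarrow> ('t \<Rightarrow> 'y \<Rightarrow> 'y) \<Rightarrow> ('x \<Rightarrow> 'y) \<Rightarrow> 'y \<Rightarrow>
   ('y \<Rightarrow> 'x \<Rightarrow> 'x) set" where
  "Cov T \<sigma> \<delta> p y0 =
     {F. (\<forall>y. F y \<in> (\<lambda>f. restrict f (p -` {y})) ` carrier (ellis_fib T \<sigma> p y0)) \<and>
         (\<forall>y. \<forall>t\<in>carrier T. F (\<delta> t y) = restrict (\<sigma> t \<circ> F y \<circ> \<sigma> (inv\<^bsub>T\<^esub> t)) (p -` {\<delta> t y}))}"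

text \<open>
  The group \<open>eE\<^bsup>fib\<^esup>\<^sub>ye\<close> of restrictions of elements of \<open>eE\<^bsup>fib\<^esup>e\<close> to \<open>e(p\<^bsup>-1\<^esup>(y))\<close>. Up to
  isomorphism it does not depend on \<open>y\<close>; it is the structure group of the factor.
\<close>

definition fibre_group ::
  "('t, 'b) monoid_scheme \<Rightarrow> ('t \<Rightarrow> 'x \<Rightarrow> 'x::metric_space) \<Rightarrow> ('x \<Rightarrow> 'y) \<Rightarrow> 'y \<Rightarrow> ('x \<Rightarrow> 'x) \<Rightarrow> 'y \<Rightarrow>
   ('x \<Rightarrow> 'x) monoid" where
  "fibre_group T \<sigma> p y0 e y =
     \<lparr>carrier = (\<lambda>f. restrict f (e ` (p -` {y}))) ` carrier (local_group (ellis_fib T \<sigma> p y0) e),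
      mult = compose (e ` (p -` {y})),
      one = restrict id (e ` (p -` {y}))\<rparr>"

end

(*
  Every f in E(X) satisfies p (f x) = p x + \<pi> f and commutes with the action, so a map of X that preserves
  the fibres of p and agrees over each orbit of Y with some element of Efib is covariant; the hypothesis
  Efib = Cov says that it lies in Efib. Elements of G = eEe over a common point of Y can therefore be
  chosen independently over the orbits of Y. This gives the product decomposition of eEfib e, and also a
  multiplicative section of G -> Y, glued from translations between fibres. The Rees matrix form is
  the same for E as for Efib, apart from the group, because Efib contains all idempotents of E.
*)
theory Submission
  imports Defs
begin

section \<open>Compact semigroups of maps\<close>

text \<open>Composition in the Ellis semigroup is continuous only in its left factor. Topology
  serves to produce idempotents and to make \<open>e S e\<close> a group; the structure of the
  kernels then follows by algebra alone. The splitting is the delicate point. A map \<open>c\<close>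
  from Y to \<open>\<G>\<close> with \<open>c (\<delta> t y) = \<sigma> t \<circ> c y\<close> can
  exist only if \<open>\<delta> t = id\<close> implies \<open>\<sigma> t = id\<close>, and the
  semidirect product is stated under this condition. Otherwise it can fail: the rotation of Z/4 by
  Z, over the rotation of Z/2, satisfies Efib = Cov, but Z/4 is not a semidirect product of Z/2 and
  Z/2. The extension of Y by \<open>\<G>fib\<close> and the Rees form over \<open>\<G>\<close>
  itself do not depend on a splitting and stand outside the condition. The choices of orbit
  representatives, lifts and times are arbitrary, so neither the section nor the product isomorphism
  is claimed to be continuous.\<close>

lemma compact_UNIV_fun:
  assumes "compact (UNIV :: 'b::topological_space set)"
  shows "compact (UNIV :: ('a \<Rightarrow> 'b) set)"
proof -
  have "compact_space (product_topology (\<lambda>_::'a. euclidean :: 'b topology) UNIV)"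
    using assms by (subst compact_space_product_topology) (simp add: compact_space_def)
  then show ?thesis
    by (metis compact_space_def compactin_euclidean_iff euclidean_product_topology topspace_euclidean)
qed

lemma compact_imp_closed_fun:
  fixes A :: "('a \<Rightarrow> 'b::t2_space) set"
  assumes "compact A"
  shows "closed A"
proof -
  have "Hausdorff_space (euclidean :: 'b topology)"
    unfolding Hausdorff_space_def disjnt_def open_openin[symmetric] using hausdorff by meson
  then have "Hausdorff_space (euclidean :: ('a \<Rightarrow> 'b) topology)"
    unfolding euclidean_product_topology[symmetric]
    by (simp add: Hausdorff_space_product_topology)
  then show ?thesis
    using compactin_imp_closedin[of euclidean A] assms by simp
qed

lemma continuous_on_eval_comp:
  fixes u :: "'b::topological_space \<Rightarrow> 'c::topological_space"
  assumes "continuous_on UNIV u"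
  shows "continuous_on A (\<lambda>f::'a \<Rightarrow> 'b. u (f x))"
  by (rule continuous_on_compose2[OF assms continuous_on_subset[OF continuous_on_product_coordinates]]) auto

lemma continuous_on_comp_right: "continuous_on A (\<lambda>f::'b \<Rightarrow> 'c::topological_space. f \<circ> (g::'a \<Rightarrow> 'b))"
  unfolding comp_def by (rule continuous_on_coordinatewise_then_product)
    (auto intro: continuous_on_subset[OF continuous_on_product_coordinates])

lemma continuous_on_comp_left:
  fixes u :: "'b::topological_space \<Rightarrow> 'c::topological_space"
  assumes "continuous_on UNIV u"
  shows "continuous_on A (\<lambda>f::'a \<Rightarrow> 'b. u \<circ> f)"
  unfolding comp_def by (rule continuous_on_coordinatewise_then_product)
    (rule continuous_on_eval_comp[OF assms])

text \<open>Composition with a fixed map on the right is always continuous for pointwise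
  convergence, on the left only if the fixed map is continuous. Hence two passes: the right factor
  goes to the closure while the left one is still in \<open>A\<close>, then the left factor
  follows.\<close>

lemma closure_comp_closed:
  fixes A :: "('a::topological_space \<Rightarrow> 'a) set"
  assumes cont: "\<And>f. f \<in> A \<Longrightarrow> continuous_on UNIV f"
    and comp: "\<And>f g. \<lbrakk>f \<in> A; g \<in> A\<rbrakk> \<Longrightarrow> f \<circ> g \<in> A"
    and f: "f \<in> closure A" and g: "g \<in> closure A"
  shows "f \<circ> g \<in> closure A"
proof -
  have *: "a \<circ> h \<in> closure A" if "a \<in> A" "h \<in> closure A" for a h
  proof -
    have "(\<lambda>f. a \<circ> f) ` closure A \<subseteq> closure A"
      by (rule image_closure_subset[OF continuous_on_comp_left[OF cont[OF that(1)]]])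
        (use comp that(1) closure_subset in blast)+
    then show ?thesis
      using that(2) by blast
  qed
  have "(\<lambda>f. f \<circ> g) ` closure A \<subseteq> closure A"
    by (rule image_closure_subset[OF continuous_on_comp_right]) (use * g in auto)
  then show ?thesis
    using f by blast
qed

lemma chain_Inter_compact_nonempty:
  fixes \<C> :: "'a::topological_space set set"
  assumes "\<C> \<noteq> {}" and "\<And>A. A \<in> \<C> \<Longrightarrow> compact A \<and> closed A \<and> A \<noteq> {}"
    and chain: "\<And>A B. \<lbrakk>A \<in> \<C>; B \<in> \<C>\<rbrakk> \<Longrightarrow> A \<subseteq> B \<or> B \<subseteq> A"
  shows "\<Inter>\<C> \<noteq> {}"
proof -
  obtain A0 where A0: "A0 \<in> \<C>"
    using assms(1) by blast
  have fin: "\<exists>A\<in>\<C>. A \<subseteq> \<Inter>F" if "finite F" "F \<subseteq> \<C>" for F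
    using that
  proof (induction F)
    case empty
    then show ?case using A0 by auto
  next
    case (insert B F)
    then obtain A where "A \<in> \<C>" "A \<subseteq> \<Inter>F" by auto
    with chain[of A B] insert.prems show ?case by auto
  qed
  have "A0 \<inter> \<Inter>\<C> \<noteq> {}"
  proof (rule compact_imp_fip)
    show "compact A0" using assms(2) A0 by blast
    show "closed T" if "T \<in> \<C>" for T
      using assms(2)[OF that] by blast
    show "A0 \<inter> \<Inter>F \<noteq> {}" if F: "finite F" "F \<subseteq> \<C>" for F
      using fin[of "insert A0 F"] F A0 assms(2) by fastforce
  qed
  then show ?thesis by blast
qed

text \<open>A minimal compact subsemigroup \<open>A\<close> consists of idempotents. For
  \<open>a\<close> in \<open>A\<close> the set \<open>A \<circ> a\<close> is all of
  \<open>A\<close>, so some \<open>b\<close> satisfies \<open>b \<circ> a = a\<close>; the closed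
  subsemigroup of all such \<open>b\<close> is again \<open>A\<close> and therefore contains
  \<open>a\<close>.\<close>

lemma Ellis_Numakura:
  fixes C :: "('a::t2_space \<Rightarrow> 'a) set"
  assumes "compact C" "C \<noteq> {}" and comp: "\<And>f g. \<lbrakk>f \<in> C; g \<in> C\<rbrakk> \<Longrightarrow> f \<circ> g \<in> C"
  obtains u where "u \<in> C" "u \<circ> u = u"
proof -
  define \<A> where "\<A> = {A. A \<subseteq> C \<and> compact A \<and> A \<noteq> {} \<and> (\<forall>f\<in>A. \<forall>g\<in>A. f \<circ> g \<in> A)}"
  \<comment> \<open>Zorn's lemma for inclusion yields maximal sets and a minimal one is wanted, so
    it is applied to complements. The union of a chain is then the complement of an intersection,
    which is nonempty by compactness.\<close>
  have "\<exists>M\<in>uminus ` \<A>. \<forall>B\<in>uminus ` \<A>. M \<subseteq> B \<longrightarrow> B = M"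
  proof (rule subset_Zorn_nonempty)
    show "uminus ` \<A> \<noteq> {}"
      using assms by (auto simp: \<A>_def)
    fix \<C> :: "('a \<Rightarrow> 'a) set set"
    assume ne: "\<C> \<noteq> {}" and ch: "subset.chain (uminus ` \<A>) \<C>"
    define \<D> where "\<D> = uminus ` \<C>"
    have D: "\<D> \<subseteq> \<A>" "\<D> \<noteq> {}"
      using ne ch by (auto simp: \<D>_def subset.chain_def)
    have chain: "A \<subseteq> B \<or> B \<subseteq> A" if "A \<in> \<D>" "B \<in> \<D>" for A B
      using ch that by (force simp: \<D>_def subset_chain_def)
    obtain A0 where A0: "A0 \<in> \<D>"
      using D(2) by blast
    have cpt: "compact A" and ne: "A \<noteq> {}" if "A \<in> \<D>" for A
      using that D(1) by (auto simp: \<A>_def)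
    have "\<Inter>\<D> \<noteq> {}"
      by (rule chain_Inter_compact_nonempty[OF D(2) _ chain])
        (simp_all add: cpt ne compact_imp_closed_fun)
    moreover have "compact (\<Inter>\<D>)"
    proof -
      have "closed (\<Inter>\<D>)"
        by (intro closed_Inter ballI compact_imp_closed_fun cpt)
      moreover have "\<Inter>\<D> = A0 \<inter> \<Inter>\<D>"
        using A0 by blast
      ultimately show ?thesis
        using compact_Int_closed[OF cpt[OF A0]] by metis
    qed
    moreover have "\<forall>f\<in>\<Inter>\<D>. \<forall>g\<in>\<Inter>\<D>. f \<circ> g \<in> \<Inter>\<D>" "\<Inter>\<D> \<subseteq> C"
      using D A0 by (auto simp: \<A>_def subset_iff)
    ultimately have "\<Inter>\<D> \<in> \<A>"
      by (simp add: \<A>_def)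
    moreover have "\<Union>\<C> = - \<Inter>\<D>"
      by (auto simp: \<D>_def)
    ultimately show "\<Union>\<C> \<in> uminus ` \<A>"
      by blast
  qed
  then obtain A where A: "A \<in> \<A>" and minA: "\<And>B. B \<in> \<A> \<Longrightarrow> B \<subseteq> A \<Longrightarrow> B = A"
    by (smt (verit, ccfv_threshold) Compl_subset_Compl_iff double_complement image_iff)
  obtain a where a: "a \<in> A"
    using A by (auto simp: \<A>_def)
  have mem: "A \<subseteq> C" "compact A" "\<And>f g. f \<in> A \<Longrightarrow> g \<in> A \<Longrightarrow> f \<circ> g \<in> A"
    using A by (auto simp: \<A>_def)
  have "(\<lambda>f. f \<circ> a) ` A \<in> \<A>"
  proof -
    have "compact ((\<lambda>f. f \<circ> a) ` A)"
      by (rule compact_continuous_image[OF continuous_on_comp_right mem(2)])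
    moreover have "(f \<circ> a) \<circ> (g \<circ> a) \<in> (\<lambda>f. f \<circ> a) ` A" if "f \<in> A" "g \<in> A" for f g
      using mem(3)[OF mem(3)[OF that(1) a] that(2)] by (auto simp: o_assoc)
    ultimately show ?thesis
      using mem a by (auto simp: \<A>_def)
  qed
  then have "(\<lambda>f. f \<circ> a) ` A = A"
    by (rule minA) (use mem a in auto)
  then obtain b where b: "b \<in> A" "b \<circ> a = a"
    using a by (metis (mono_tags, lifting) image_iff)
  have "{f \<in> A. f \<circ> a = a} \<in> \<A>"
  proof -
    have "closed {f. f \<circ> a = a}"
      unfolding fun_eq_iff comp_def
      by (intro closed_Collect_all closed_Collect_eq) auto
    moreover have "{f \<in> A. f \<circ> a = a} = A \<inter> {f. f \<circ> a = a}"
      by blast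
    ultimately have "compact {f \<in> A. f \<circ> a = a}"
      using compact_Int_closed[OF mem(2)] by simp
    then show ?thesis
      using mem b by (auto simp: \<A>_def simp flip: o_assoc)
  qed
  then have "{f \<in> A. f \<circ> a = a} = A"
    by (rule minA) auto
  then show thesis
    using that a mem by blast
qed

text \<open>
  Minimality of the idempotent replaces the usual detour through minimal left ideals: the compact
  semigroup \<open>S g\<close> contains an idempotent \<open>u = s g\<close>, and \<open>e u\<close> is an idempotent below \<open>e\<close>, whence
  \<open>(e s e) g = e\<close>.
\<close>

lemma group_local_group_minimal:
  fixes S :: "('a::t2_space \<Rightarrow> 'a, 'b) monoid_scheme"
  assumes comp: "compact (carrier S)" and mult: "mult S = (\<circ>)"
    and closed: "\<And>f g. \<lbrakk>f \<in> carrier S; g \<in> carrier S\<rbrakk> \<Longrightarrow> f \<circ> g \<in> carrier S"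
    and e: "minimal_idempotent S e"
  shows "group (local_group S e)"
proof -
  have eS: "e \<in> carrier S" and ee: "e \<circ> e = e"
    and emin: "\<And>p. \<lbrakk>p \<in> carrier S; p \<circ> p = p; p \<circ> e = p; e \<circ> p = p\<rbrakk> \<Longrightarrow> p = e"
    using e by (auto simp: minimal_idempotent_def idempotent_in_def mult)
  have eee: "e \<circ> (e \<circ> f) = e \<circ> f" for f
    by (simp add: o_assoc ee)
  show ?thesis
  proof (rule groupI)
    fix g
    assume "g \<in> carrier (local_group S e)"
    then obtain g0 where g: "g = e \<circ> g0 \<circ> e" "g0 \<in> carrier S"
      by (auto simp: local_group_def mult)
    have gS: "g \<in> carrier S"
      using g closed eS by simp
    have ge: "g \<circ> e = g" "e \<circ> g = g"
      by (simp_all add: g o_assoc[symmetric] ee eee)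
    let ?C = "(\<lambda>f. f \<circ> g) ` carrier S"
    have "compact ?C" "?C \<noteq> {}"
      using eS by (auto intro: compact_continuous_image[OF continuous_on_comp_right comp])
    moreover have "f \<circ> h \<in> ?C" if "f \<in> ?C" "h \<in> ?C" for f h
      using that gS closed by (fastforce simp: o_assoc)
    ultimately obtain u where "u \<in> ?C" and uu: "u \<circ> u = u"
      by (rule Ellis_Numakura)
    then obtain s where s: "s \<in> carrier S" and u: "u = s \<circ> g"
      by blast
    have ue: "u \<circ> e = u"
      by (simp add: u o_assoc[symmetric] ge)
    have "e \<circ> u = e"
    proof (rule emin)
      show "e \<circ> u \<in> carrier S"
        using closed eS s gS u by simp
      show "e \<circ> u \<circ> (e \<circ> u) = e \<circ> u"
        by (metis comp_assoc ue uu)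
    qed (simp_all add: o_assoc[symmetric] ue eee)
    then have "(e \<circ> s \<circ> e) \<circ> g = e"
      by (simp add: u o_assoc[symmetric] ge)
    then show "\<exists>h\<in>carrier (local_group S e). h \<otimes>\<^bsub>local_group S e\<^esub> g = \<one>\<^bsub>local_group S e\<^esub>"
      using s by (auto simp: local_group_def mult)
  next
    show "\<one>\<^bsub>local_group S e\<^esub> \<in> carrier (local_group S e)"
      using eS by (auto simp: local_group_def mult ee intro!: exI[of _ e])
  next
    fix f g
    assume "f \<in> carrier (local_group S e)" "g \<in> carrier (local_group S e)"
    then obtain f0 g0 where "f = e \<circ> f0 \<circ> e" "f0 \<in> carrier S" "g = e \<circ> g0 \<circ> e" "g0 \<in> carrier S"
      by (auto simp: local_group_def mult)
    then show "f \<otimes>\<^bsub>local_group S e\<^esub> g \<in> carrier (local_group S e)"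
      using closed eS
      by (auto simp: local_group_def mult o_assoc[symmetric] eee intro!: exI[of _ "f0 \<circ> (e \<circ> g0)"])
  qed (auto simp: local_group_def mult o_assoc[symmetric] eee)
qed


section \<open>Completely simple kernels and Rees matrix semigroups\<close>

text \<open>
  Both conditions force idempotency (\<open>r r = r e r = r e = r\<close>). When \<open>eSe\<close> is a group, these are
  the idempotents of the minimal left, respectively right, ideal of \<open>e\<close>, and they represent the minimal
  right, respectively left, ideals of the kernel.
\<close>

definition idempotent_column :: "('a, 'b) monoid_scheme \<Rightarrow> 'a \<Rightarrow> 'a set" where
  "idempotent_column S e = {r \<in> carrier S. r \<otimes>\<^bsub>S\<^esub> e = r \<and> e \<otimes>\<^bsub>S\<^esub> r = e}"

definition idempotent_row :: "('a, 'b) monoid_scheme \<Rightarrow> 'a \<Rightarrow> 'a set" where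
  "idempotent_row S e = {q \<in> carrier S. q \<otimes>\<^bsub>S\<^esub> e = e \<and> e \<otimes>\<^bsub>S\<^esub> q = q}"

text \<open>That \<open>e S e\<close> is a group is all that the description of the kernel takes
  from compactness and minimality. The locale is interpreted for the Ellis semigroup and again for
  its fibre-preserving part.\<close>

locale group_idempotent = monoid S for S (structure) +
  fixes e
  assumes idem: "idempotent_in S e"
    and local_group: "group (local_group S e)"
begin

abbreviation "H \<equiv> carrier (local_group S e)"
abbreviation "C \<equiv> idempotent_column S e"
abbreviation "W \<equiv> idempotent_row S e"
abbreviation "K \<equiv> semigroup_kernel S"

lemma e_closed [simp, intro]: "e \<in> carrier S" and ee [simp]: "e \<otimes> e = e"
  using idem by (auto simp: idempotent_in_def)

lemma e_idem_left [simp]: "x \<in> carrier S \<Longrightarrow> e \<otimes> (e \<otimes> x) = e \<otimes> x"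
  by (simp flip: m_assoc)

lemma mem_H: "g \<in> H \<longleftrightarrow> g \<in> carrier S \<and> e \<otimes> g = g \<and> g \<otimes> e = g"
  by (auto simp: local_group_def m_assoc intro!: exI[of _ g])

lemma e_absorb: "\<lbrakk>e \<otimes> x = x; x \<in> carrier S; y \<in> carrier S\<rbrakk> \<Longrightarrow> e \<otimes> (x \<otimes> y) = x \<otimes> y"
  by (simp flip: m_assoc)

lemma mult_local_group: "mult (local_group S e) = mult S"
  by (simp add: local_group_def)

lemma mem_C: "r \<in> C \<longleftrightarrow> r \<in> carrier S \<and> r \<otimes> e = r \<and> e \<otimes> r = e"
  by (auto simp: idempotent_column_def)

lemma mem_W: "q \<in> W \<longleftrightarrow> q \<in> carrier S \<and> q \<otimes> e = e \<and> e \<otimes> q = q"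
  by (auto simp: idempotent_row_def)

lemma mult_H: "\<lbrakk>g \<in> H; h \<in> H\<rbrakk> \<Longrightarrow> g \<otimes> h \<in> H"
  using monoid.m_closed[OF group.is_monoid[OF local_group]] by (simp add: local_group_def)

lemma inverse_H:
  assumes "g \<in> H"
  obtains h where "h \<in> H" "g \<otimes> h = e" "h \<otimes> g = e"
proof
  let ?h = "inv\<^bsub>local_group S e\<^esub> g"
  show "?h \<in> H"
    using group.inv_closed[OF local_group assms] .
  show "g \<otimes> ?h = e" "?h \<otimes> g = e"
    using group.r_inv[OF local_group assms] group.l_inv[OF local_group assms]
    by (simp_all add: local_group_def)
qed

section \<open>Factorisation of the kernel elements\<close>

lemma idem_C: "r \<in> C \<Longrightarrow> r \<otimes> r = r"
  using m_assoc[of r e r] by (simp add: mem_C)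

lemma idem_W: "q \<in> W \<Longrightarrow> q \<otimes> q = q"
  using m_assoc[of q e q] by (simp add: mem_W)

text \<open>The elements \<open>u = e a e\<close> and \<open>v = e b e\<close> are invertible in
  \<open>H\<close>, so \<open>a e b = (a u\<inverse>) (u v) (v\<inverse> b)\<close>. Dividing by the
  group component leaves idempotents outside: \<open>e a u\<inverse> = u u\<inverse> = e\<close>,
  and dually for \<open>b\<close>.\<close>

lemma decompose:
  assumes "a \<in> carrier S" "b \<in> carrier S"
  obtains r g q where "r \<in> C" "g \<in> H" "q \<in> W" "a \<otimes> e \<otimes> b = r \<otimes> g \<otimes> q"
proof -
  let ?u = "e \<otimes> a \<otimes> e" and ?v = "e \<otimes> b \<otimes> e"
  have uv: "?u \<in> H" "?v \<in> H"
    using assms by (auto simp: mem_H m_assoc)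
  obtain u' where u': "u' \<in> H" "?u \<otimes> u' = e" "u' \<otimes> ?u = e"
    using inverse_H[OF uv(1)] .
  obtain v' where v': "v' \<in> H" "?v \<otimes> v' = e" "v' \<otimes> ?v = e"
    using inverse_H[OF uv(2)] .
  have S: "u' \<in> carrier S" "v' \<in> carrier S" "e \<otimes> u' = u'" "u' \<otimes> e = u'" "e \<otimes> v' = v'" "v' \<otimes> e = v'"
    using u' v' by (auto simp: mem_H)
  have r: "a \<otimes> u' \<in> C"
  proof -
    have "e \<otimes> (a \<otimes> u') = ?u \<otimes> u'"
      using assms S by (simp add: m_assoc)
    then show ?thesis
      using assms S u' by (simp add: mem_C m_assoc)
  qed
  have q: "v' \<otimes> b \<in> W"
  proof -
    have "v' \<otimes> b \<otimes> e = v' \<otimes> ?v"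
      using assms S by (metis e_closed m_assoc m_closed)
    moreover have "e \<otimes> (v' \<otimes> b) = v' \<otimes> b"
      using assms S by (simp flip: m_assoc)
    ultimately show ?thesis
      using assms S v' by (simp add: mem_W)
  qed
  have "a \<otimes> u' \<otimes> (?u \<otimes> ?v) \<otimes> (v' \<otimes> b) = a \<otimes> (u' \<otimes> ?u) \<otimes> (?v \<otimes> v') \<otimes> b"
    using assms S by (simp add: m_assoc e_absorb)
  also have "\<dots> = a \<otimes> e \<otimes> b"
    unfolding u'(3) v'(2) using assms by (simp add: m_assoc)
  finally show thesis
    using that[OF r mult_H[OF uv] q] by simp
qed

text \<open>Every two-sided ideal contains some \<open>e x e\<close>. This is invertible in
  \<open>H\<close>, so the ideal contains \<open>e\<close> and with it all of
  \<open>S e S\<close>.\<close>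

lemma kernel_eq: "K = {a \<otimes> e \<otimes> b |a b. a \<in> carrier S \<and> b \<in> carrier S}" (is "_ = ?K")
  unfolding semigroup_kernel_def
proof (rule Least_equality)
  have "\<exists>c d. s \<otimes> (a \<otimes> e \<otimes> b) = c \<otimes> e \<otimes> d \<and> c \<in> carrier S \<and> d \<in> carrier S"
    "\<exists>c d. (a \<otimes> e \<otimes> b) \<otimes> s = c \<otimes> e \<otimes> d \<and> c \<in> carrier S \<and> d \<in> carrier S"
    if "s \<in> carrier S" "a \<in> carrier S" "b \<in> carrier S" for s a b
  proof -
    show "\<exists>c d. s \<otimes> (a \<otimes> e \<otimes> b) = c \<otimes> e \<otimes> d \<and> c \<in> carrier S \<and> d \<in> carrier S"
      using that by (intro exI[of _ "s \<otimes> a"] exI[of _ b]) (simp add: m_assoc)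
    show "\<exists>c d. (a \<otimes> e \<otimes> b) \<otimes> s = c \<otimes> e \<otimes> d \<and> c \<in> carrier S \<and> d \<in> carrier S"
      using that by (intro exI[of _ a] exI[of _ "b \<otimes> s"]) (simp add: m_assoc)
  qed
  moreover have "e \<otimes> e \<otimes> e \<in> ?K"
    by blast
  ultimately show "left_ideal S ?K \<and> right_ideal S ?K"
    unfolding left_ideal_def right_ideal_def by auto
next
  fix J
  assume "left_ideal S J \<and> right_ideal S J"
  then have J: "J \<noteq> {}" "J \<subseteq> carrier S" and left: "\<And>s x. s \<in> carrier S \<Longrightarrow> x \<in> J \<Longrightarrow> s \<otimes> x \<in> J"
    and right: "\<And>s x. s \<in> carrier S \<Longrightarrow> x \<in> J \<Longrightarrow> x \<otimes> s \<in> J"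
    by (auto simp: left_ideal_def right_ideal_def)
  obtain x where x: "x \<in> J"
    using J by blast
  have "e \<otimes> x \<otimes> e \<in> J"
    using left right x by simp
  moreover have "e \<otimes> x \<otimes> e \<in> H"
    using x J by (auto simp: mem_H m_assoc)
  then obtain h where h: "h \<in> H" "e \<otimes> x \<otimes> e \<otimes> h = e"
    by (rule inverse_H)
  ultimately have "e \<in> J"
    using right[of h "e \<otimes> x \<otimes> e"] by (simp add: mem_H)
  then show "?K \<subseteq> J"
    using left right by auto
qed

lemma K_closed: "k \<in> K \<Longrightarrow> k \<in> carrier S"
  by (auto simp: kernel_eq)

lemma kernel_ideal:
  assumes "k \<in> K" "s \<in> carrier S"
  shows "s \<otimes> k \<in> K" "k \<otimes> s \<in> K"
proof -
  obtain a b where k: "k = a \<otimes> e \<otimes> b" "a \<in> carrier S" "b \<in> carrier S"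
    using assms(1) by (auto simp: kernel_eq)
  have "s \<otimes> k = (s \<otimes> a) \<otimes> e \<otimes> b" "k \<otimes> s = a \<otimes> e \<otimes> (b \<otimes> s)"
    using assms(2) k by (simp_all add: m_assoc)
  then show "s \<otimes> k \<in> K" "k \<otimes> s \<in> K"
    using assms(2) k m_closed unfolding kernel_eq by blast+
qed

lemma e_in_K: "e \<in> K"
  by (auto simp: kernel_eq intro!: exI[of _ e])

lemma H_subset_K: "H \<subseteq> K" and C_subset_K: "C \<subseteq> K" and W_subset_K: "W \<subseteq> K"
proof -
  show "H \<subseteq> K"
  proof
    fix g assume "g \<in> H"
    then show "g \<in> K"
      using kernel_ideal(1)[OF e_in_K, of g] by (simp add: mem_H)
  qed
  show "C \<subseteq> K"
  proof
    fix r assume "r \<in> C"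
    then show "r \<in> K"
      using kernel_ideal(1)[OF e_in_K, of r] by (simp add: mem_C)
  qed
  show "W \<subseteq> K"
  proof
    fix q assume "q \<in> W"
    then show "q \<in> K"
      using kernel_ideal(2)[OF e_in_K, of q] by (simp add: mem_W)
  qed
qed

lemma kernel_decompose:
  assumes "k \<in> K"
  obtains r g q where "r \<in> C" "g \<in> H" "q \<in> W" "k = r \<otimes> g \<otimes> q"
proof -
  obtain a b where k: "k = a \<otimes> e \<otimes> b" "a \<in> carrier S" "b \<in> carrier S"
    using assms by (auto simp: kernel_eq)
  show thesis
    by (rule decompose[OF k(2,3)]) (simp add: that k(1))
qed

lemma decompose_left: "\<lbrakk>r \<in> C; g \<in> H; q \<in> W\<rbrakk> \<Longrightarrow> e \<otimes> (r \<otimes> g \<otimes> q) = g \<otimes> q"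
  by (simp add: mem_C mem_H mem_W flip: m_assoc)

lemma decompose_right: "\<lbrakk>r \<in> C; g \<in> H; q \<in> W\<rbrakk> \<Longrightarrow> r \<otimes> g \<otimes> q \<otimes> e = r \<otimes> g"
  by (simp add: mem_C mem_H mem_W m_assoc)

text \<open>Multiplying by \<open>e\<close> on both sides absorbs \<open>r\<close> and
  \<open>q\<close> and leaves \<open>g\<close>. Multiplying by \<open>e\<close> on one side only and
  then dividing by \<open>g\<close> isolates \<open>r\<close> or \<open>q\<close>.\<close>

lemma decompose_unique:
  assumes "r \<in> C" "g \<in> H" "q \<in> W" "r' \<in> C" "g' \<in> H" "q' \<in> W"
    and eq: "r \<otimes> g \<otimes> q = r' \<otimes> g' \<otimes> q'"
  shows "r = r' \<and> g = g' \<and> q = q'"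
proof -
  note mem = assms(1-6)[unfolded mem_C mem_H mem_W]
  have left: "g \<otimes> q = g' \<otimes> q'"
    using decompose_left[OF assms(1-3)] decompose_left[OF assms(4-6)] eq by simp
  then have "g \<otimes> q \<otimes> e = g' \<otimes> q' \<otimes> e"
    by simp
  then have g: "g = g'"
    using mem by (simp add: m_assoc)
  have right: "r \<otimes> g = r' \<otimes> g"
    using decompose_right[OF assms(1-3)] decompose_right[OF assms(4-6)] eq g by simp
  obtain h where h: "h \<in> H" "g \<otimes> h = e" "h \<otimes> g = e"
    using inverse_H assms by blast
  have hS: "h \<in> carrier S"
    using h(1) by (simp add: mem_H)
  have "r \<otimes> g \<otimes> h = r' \<otimes> g \<otimes> h"
    using right by simp
  then have "r = r'"
    using mem h(2) hS by (simp add: m_assoc)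
  moreover have "h \<otimes> (g \<otimes> q) = h \<otimes> (g \<otimes> q')"
    using left g by simp
  then have "(h \<otimes> g) \<otimes> q = (h \<otimes> g) \<otimes> q'"
    using mem hS by (simp add: m_assoc)
  then have "q = q'"
    using mem h(3) by simp
  ultimately show ?thesis
    using g by simp
qed

section \<open>The kernel as a semigroup: its local group and its minimal one-sided ideals\<close>

lemma local_group_kernel: "local_group (S\<lparr>carrier := K\<rparr>) e = local_group S e"
proof -
  have "\<exists>k\<in>K. e \<otimes> s \<otimes> e = e \<otimes> k \<otimes> e" if "s \<in> carrier S" for s
    using that by (intro bexI[of _ "e \<otimes> s"]) (simp_all add: m_assoc kernel_ideal e_in_K)
  then show ?thesis
    using K_closed unfolding local_group_def by auto
qed

text \<open>For \<open>r\<close> in \<open>C\<close> this is the right ideal \<open>r K\<close>,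
  because \<open>r\<close> is idempotent; as a fixed-point set its membership is an equation.
  Dually, \<open>row_ideal q\<close> is \<open>K q\<close>.\<close>

definition column_ideal :: "'a \<Rightarrow> 'a set" where
  "column_ideal r = {k \<in> K. r \<otimes> k = k}"

definition row_ideal :: "'a \<Rightarrow> 'a set" where
  "row_ideal q = {k \<in> K. k \<otimes> q = k}"

lemma right_ideal_column_ideal:
  assumes "r \<in> C"
  shows "right_ideal (S\<lparr>carrier := K\<rparr>) (column_ideal r)"
proof -
  have "r \<in> column_ideal r"
    using assms C_subset_K idem_C by (auto simp: column_ideal_def)
  moreover have "r \<otimes> (a \<otimes> s) = r \<otimes> a \<otimes> s" if "a \<in> K" "s \<in> K" for a s
    using that assms by (simp add: K_closed mem_C m_assoc)
  ultimately show ?thesis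
    by (auto simp: right_ideal_def column_ideal_def kernel_ideal K_closed)
qed

lemma left_ideal_row_ideal:
  assumes "q \<in> W"
  shows "left_ideal (S\<lparr>carrier := K\<rparr>) (row_ideal q)"
proof -
  have "q \<in> row_ideal q"
    using assms W_subset_K idem_W by (auto simp: row_ideal_def)
  moreover have "s \<otimes> a \<otimes> q = s \<otimes> (a \<otimes> q)" if "a \<in> K" "s \<in> K" for a s
    using that assms by (simp add: K_closed mem_W m_assoc)
  ultimately show ?thesis
    by (auto simp: left_ideal_def row_ideal_def kernel_ideal K_closed)
qed

text \<open>Multiplying \<open>r g q\<close> on the right by
  \<open>g\<inverse> = e g\<inverse>\<close> absorbs \<open>q\<close>, since \<open>q e = e\<close>,
  and returns \<open>r\<close>. This gives the minimality of \<open>r K\<close>, and also that every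
  right ideal of the kernel contains some \<open>r K\<close>.\<close>

lemma column_ideal_subset:
  assumes R: "right_ideal (S\<lparr>carrier := K\<rparr>) R" and x: "x \<in> R"
    and rgq: "x = r \<otimes> g \<otimes> q" "r \<in> C" "g \<in> H" "q \<in> W"
  shows "column_ideal r \<subseteq> R"
proof -
  obtain h where h: "h \<in> H" "g \<otimes> h = e" "h \<otimes> g = e"
    using inverse_H rgq by blast
  have "x \<otimes> h = x \<otimes> e \<otimes> h"
    using h x R K_closed by (auto simp: right_ideal_def m_assoc mem_H subset_iff)
  also have "\<dots> = r"
    using h rgq by (simp add: decompose_right m_assoc mem_H mem_C)
  finally have "r \<in> R"
    using R x h(1) H_subset_K by (auto simp: right_ideal_def)
  then show ?thesis
    using R unfolding right_ideal_def column_ideal_def by force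
qed

lemma row_ideal_subset:
  assumes L: "left_ideal (S\<lparr>carrier := K\<rparr>) L" and x: "x \<in> L"
    and rgq: "x = r \<otimes> g \<otimes> q" "r \<in> C" "g \<in> H" "q \<in> W"
  shows "row_ideal q \<subseteq> L"
proof -
  obtain h where h: "h \<in> H" "g \<otimes> h = e" "h \<otimes> g = e"
    using inverse_H rgq by blast
  have "h \<otimes> x = h \<otimes> (e \<otimes> x)"
    using h x L K_closed by (auto simp: left_ideal_def mem_H subset_iff simp flip: m_assoc)
  also have "\<dots> = q"
    using h rgq by (simp add: decompose_left mem_H mem_W flip: m_assoc)
  finally have "q \<in> L"
    using L x h(1) H_subset_K by (auto simp: left_ideal_def)
  then show ?thesis
    using L unfolding left_ideal_def row_ideal_def by force
qed

lemma decompose_column: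
  assumes "r \<in> C" "x \<in> column_ideal r"
  obtains g q where "g \<in> H" "q \<in> W" "x = r \<otimes> g \<otimes> q"
proof -
  obtain r' g q where rgq: "r' \<in> C" "g \<in> H" "q \<in> W" "x = r' \<otimes> g \<otimes> q"
    using kernel_decompose[of x] assms(2) by (auto simp: column_ideal_def)
  have "r \<otimes> r' = r"
    using assms(1) rgq(1) m_assoc[of r e r'] by (simp add: mem_C)
  moreover have "r \<otimes> x = (r \<otimes> r') \<otimes> g \<otimes> q"
    using assms(1) rgq by (simp add: mem_C mem_H mem_W m_assoc)
  ultimately have "x = r \<otimes> g \<otimes> q"
    using assms(2) by (simp add: column_ideal_def)
  with rgq that show thesis by blast
qed

lemma decompose_row:
  assumes "q \<in> W" "x \<in> row_ideal q"
  obtains r g where "r \<in> C" "g \<in> H" "x = r \<otimes> g \<otimes> q"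
proof -
  obtain r g q' where rgq: "r \<in> C" "g \<in> H" "q' \<in> W" "x = r \<otimes> g \<otimes> q'"
    using kernel_decompose[of x] assms(2) by (auto simp: row_ideal_def)
  have "q' \<otimes> q = q"
    using assms(1) rgq(3) m_assoc[of q' e q] by (simp add: mem_W)
  moreover have "x \<otimes> q = r \<otimes> g \<otimes> (q' \<otimes> q)"
    using assms(1) rgq by (simp add: mem_C mem_H mem_W m_assoc)
  ultimately have "x = r \<otimes> g \<otimes> q"
    using assms(2) by (simp add: row_ideal_def)
  with rgq that show thesis by blast
qed

text \<open>Injectivity: elements of \<open>C\<close> multiply as left zeros,
  \<open>r r' = r e r' = r e = r\<close>, whereas equal ideals force
  \<open>r r' = r'\<close>.\<close>

lemma bij_betw_column_ideal: "bij_betw column_ideal C (min_right_ideals (S\<lparr>carrier := K\<rparr>))"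
  unfolding bij_betw_def
proof (intro conjI inj_onI equalityI subsetI)
  fix r r'
  assume rr': "r \<in> C" "r' \<in> C" "column_ideal r = column_ideal r'"
  then have "r \<otimes> r' = r'"
    using C_subset_K idem_C by (auto simp: column_ideal_def)
  moreover have "r \<otimes> r' = r"
    using rr'(1,2) m_assoc[of r e r'] by (simp add: mem_C)
  ultimately show "r = r'"
    by simp
next
  fix R
  assume "R \<in> column_ideal ` C"
  then obtain r where r: "r \<in> C" "R = column_ideal r"
    by blast
  have "R' = R" if R': "right_ideal (S\<lparr>carrier := K\<rparr>) R'" "R' \<subseteq> R" for R'
  proof -
    obtain x where x: "x \<in> R'"
      using R' by (auto simp: right_ideal_def)
    then obtain g q where "g \<in> H" "q \<in> W" "x = r \<otimes> g \<otimes> q"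
      using decompose_column[OF r(1)] R' r(2) by blast
    then show ?thesis
      using column_ideal_subset[OF R'(1) x] r R'(2) by blast
  qed
  then show "R \<in> min_right_ideals (S\<lparr>carrier := K\<rparr>)"
    using right_ideal_column_ideal r by (auto simp: min_right_ideals_def)
next
  fix R
  assume R: "R \<in> min_right_ideals (S\<lparr>carrier := K\<rparr>)"
  then have Ri: "right_ideal (S\<lparr>carrier := K\<rparr>) R"
    by (simp add: min_right_ideals_def)
  then obtain x where x: "x \<in> R" "x \<in> K"
    by (auto simp: right_ideal_def)
  obtain r g q where rgq: "r \<in> C" "g \<in> H" "q \<in> W" "x = r \<otimes> g \<otimes> q"
    by (rule kernel_decompose[OF x(2)])
  then have "column_ideal r = R"
    using column_ideal_subset[OF Ri x(1)] R right_ideal_column_ideal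
    by (simp add: min_right_ideals_def)
  then show "R \<in> column_ideal ` C"
    using rgq(1) by blast
qed

lemma bij_betw_row_ideal: "bij_betw row_ideal W (min_left_ideals (S\<lparr>carrier := K\<rparr>))"
  unfolding bij_betw_def
proof (intro conjI inj_onI equalityI subsetI)
  fix q q'
  assume qq': "q \<in> W" "q' \<in> W" "row_ideal q = row_ideal q'"
  then have "q' \<otimes> q = q'"
    using W_subset_K idem_W by (auto simp: row_ideal_def)
  moreover have "q' \<otimes> q = q"
    using qq'(1,2) m_assoc[of q' e q] by (simp add: mem_W)
  ultimately show "q = q'"
    by simp
next
  fix L
  assume "L \<in> row_ideal ` W"
  then obtain q where q: "q \<in> W" "L = row_ideal q"
    by blast
  have "L' = L" if L': "left_ideal (S\<lparr>carrier := K\<rparr>) L'" "L' \<subseteq> L" for L'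
  proof -
    obtain x where x: "x \<in> L'"
      using L' by (auto simp: left_ideal_def)
    then obtain r g where "r \<in> C" "g \<in> H" "x = r \<otimes> g \<otimes> q"
      using decompose_row[OF q(1)] L' q(2) by blast
    then show ?thesis
      using row_ideal_subset[OF L'(1) x] q L'(2) by blast
  qed
  then show "L \<in> min_left_ideals (S\<lparr>carrier := K\<rparr>)"
    using left_ideal_row_ideal q by (auto simp: min_left_ideals_def)
next
  fix L
  assume L: "L \<in> min_left_ideals (S\<lparr>carrier := K\<rparr>)"
  then have Li: "left_ideal (S\<lparr>carrier := K\<rparr>) L"
    by (simp add: min_left_ideals_def)
  then obtain x where x: "x \<in> L" "x \<in> K"
    by (auto simp: left_ideal_def)
  obtain r g q where rgq: "r \<in> C" "g \<in> H" "q \<in> W" "x = r \<otimes> g \<otimes> q"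
    by (rule kernel_decompose[OF x(2)])
  then have "row_ideal q = L"
    using row_ideal_subset[OF Li x(1)] L left_ideal_row_ideal
    by (simp add: min_left_ideals_def)
  then show "L \<in> row_ideal ` W"
    using rgq(3) by blast
qed

section \<open>The sandwich matrix and the Rees form of the kernel\<close>

lemma e_in_C: "e \<in> C" and e_in_W: "e \<in> W"
  by (simp_all add: mem_C mem_W)

lemma e_in_column_ideal_iff: "r \<in> C \<Longrightarrow> e \<in> column_ideal r \<longleftrightarrow> r = e"
  by (auto simp: column_ideal_def mem_C e_in_K)

lemma e_in_row_ideal_iff: "q \<in> W \<Longrightarrow> e \<in> row_ideal q \<longleftrightarrow> q = e"
  by (auto simp: row_ideal_def mem_W e_in_K)

lemma idempotent_H: "\<lbrakk>g \<in> H; g \<otimes> g = g\<rbrakk> \<Longrightarrow> g = e"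
proof -
  assume g: "g \<in> H" "g \<otimes> g = g"
  obtain h where h: "h \<in> H" "g \<otimes> h = e"
    using inverse_H[OF g(1)] by blast
  have "g \<otimes> (g \<otimes> h) = g \<otimes> h"
    using g h(1) by (simp add: mem_H flip: m_assoc)
  then show "g = e"
    using g(1) h by (simp add: mem_H)
qed

text \<open>If \<open>x\<close> is idempotent and \<open>x e = x\<close>, then \<open>e x\<close> is
  an idempotent of the group \<open>H\<close>, hence equal to \<open>e\<close>, and
  \<open>x = r x = r e x = r\<close>. This evaluates a definite description in
  \<open>rees_matrix\<close>.\<close>

lemma idempotent_column_ideal_iff:
  assumes "r \<in> C"
  shows "idempotent_in (S\<lparr>carrier := K\<rparr>) x \<and> x \<in> column_ideal r \<inter> row_ideal e \<longleftrightarrow> x = r"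
proof
  assume "idempotent_in (S\<lparr>carrier := K\<rparr>) x \<and> x \<in> column_ideal r \<inter> row_ideal e"
  then have x: "x \<otimes> x = x" "r \<otimes> x = x" "x \<otimes> e = x" "x \<in> carrier S"
    using K_closed by (auto simp: idempotent_in_def column_ideal_def row_ideal_def)
  have "e \<otimes> x = e"
  proof (rule idempotent_H)
    show "e \<otimes> x \<in> H"
      using x by (simp add: mem_H m_assoc)
    show "e \<otimes> x \<otimes> (e \<otimes> x) = e \<otimes> x"
      using x m_assoc[of x e x] by (simp add: m_assoc)
  qed
  then show "x = r"
    using x assms m_assoc[of r e x] by (simp add: mem_C)
next
  assume "x = r"
  then show "idempotent_in (S\<lparr>carrier := K\<rparr>) x \<and> x \<in> column_ideal r \<inter> row_ideal e"
    using assms C_subset_K idem_C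
    by (auto simp: idempotent_in_def column_ideal_def row_ideal_def mem_C)
qed

lemma idempotent_row_ideal_iff:
  assumes "q \<in> W"
  shows "idempotent_in (S\<lparr>carrier := K\<rparr>) x \<and> x \<in> column_ideal e \<inter> row_ideal q \<longleftrightarrow> x = q"
proof
  assume "idempotent_in (S\<lparr>carrier := K\<rparr>) x \<and> x \<in> column_ideal e \<inter> row_ideal q"
  then have x: "x \<otimes> x = x" "x \<otimes> q = x" "e \<otimes> x = x" "x \<in> carrier S"
    using K_closed by (auto simp: idempotent_in_def column_ideal_def row_ideal_def)
  have "x \<otimes> e = e"
  proof (rule idempotent_H)
    have exe: "e \<otimes> (x \<otimes> e) = x \<otimes> e"
      using x m_assoc[of e x e] by simp
    then show "x \<otimes> e \<in> H"
      using x by (simp add: mem_H m_assoc)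
    show "x \<otimes> e \<otimes> (x \<otimes> e) = x \<otimes> e"
      using x exe m_assoc[of x x e] by (simp add: m_assoc)
  qed
  then show "x = q"
    using x assms m_assoc[of x e q] by (simp add: mem_W)
next
  assume "x = q"
  then show "idempotent_in (S\<lparr>carrier := K\<rparr>) x \<and> x \<in> column_ideal e \<inter> row_ideal q"
    using assms W_subset_K idem_W
    by (auto simp: idempotent_in_def column_ideal_def row_ideal_def mem_W)
qed

lemma rees_matrix_kernel:
  assumes "r \<in> C" "q \<in> W"
  shows "rees_matrix (S\<lparr>carrier := K\<rparr>) e (row_ideal q) (column_ideal r) = q \<otimes> r"
proof -
  have R0: "(THE R. R \<in> min_right_ideals (S\<lparr>carrier := K\<rparr>) \<and> e \<in> R) = column_ideal e"
    using bij_betw_imp_surj_on[OF bij_betw_column_ideal, symmetric] e_in_C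
    by (intro the_equality) (auto simp: e_in_column_ideal_iff)
  have L0: "(THE L. L \<in> min_left_ideals (S\<lparr>carrier := K\<rparr>) \<and> e \<in> L) = row_ideal e"
    using bij_betw_imp_surj_on[OF bij_betw_row_ideal, symmetric] e_in_W
    by (intro the_equality) (auto simp: e_in_row_ideal_iff)
  show ?thesis
    unfolding rees_matrix_def Let_def R0 L0
      idempotent_column_ideal_iff[OF assms(1)] idempotent_row_ideal_iff[OF assms(2)]
    by simp
qed

lemma sandwich_in_H: "\<lbrakk>r \<in> C; q \<in> W\<rbrakk> \<Longrightarrow> q \<otimes> r \<in> H"
  using m_assoc[of e q r] m_assoc[of q r e] by (simp add: mem_C mem_W mem_H)

lemma rees_iso_kernel:
  "(\<lambda>(r, g, q). r \<otimes> g \<otimes> q) \<in>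
     Group.iso (rees_semigroup (local_group S e) C W (\<lambda>q r. q \<otimes> r)) (S\<lparr>carrier := K\<rparr>)"
proof (rule isoI)
  show "(\<lambda>(r, g, q). r \<otimes> g \<otimes> q) \<in>
     hom (rees_semigroup (local_group S e) C W (\<lambda>q r. q \<otimes> r)) (S\<lparr>carrier := K\<rparr>)"
  proof (rule homI; clarsimp simp: rees_semigroup_def)
    show "r \<otimes> g \<otimes> q \<in> K" if "r \<in> C" "g \<in> H" "q \<in> W" for r g q
      using that C_subset_K kernel_ideal(2) by (simp add: mem_H mem_W subset_iff)
    show "r \<otimes> (g \<otimes>\<^bsub>local_group S e\<^esub> (q \<otimes> r') \<otimes>\<^bsub>local_group S e\<^esub> g') \<otimes> q' =
        r \<otimes> g \<otimes> q \<otimes> (r' \<otimes> g' \<otimes> q')"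
      if "r \<in> C" "g \<in> H" "q \<in> W" "r' \<in> C" "g' \<in> H" "q' \<in> W" for r g q r' g' q'
      using that by (simp add: mult_local_group mem_H mem_W mem_C m_assoc)
  qed
  show "bij_betw (\<lambda>(r, g, q). r \<otimes> g \<otimes> q)
     (carrier (rees_semigroup (local_group S e) C W (\<lambda>q r. q \<otimes> r))) (carrier (S\<lparr>carrier := K\<rparr>))"
    unfolding bij_betw_def
  proof
    show "inj_on (\<lambda>(r, g, q). r \<otimes> g \<otimes> q)
        (carrier (rees_semigroup (local_group S e) C W (\<lambda>q r. q \<otimes> r)))"
      by (rule inj_onI) (use decompose_unique in \<open>fastforce simp: rees_semigroup_def\<close>)
    show "(\<lambda>(r, g, q). r \<otimes> g \<otimes> q) `
        carrier (rees_semigroup (local_group S e) C W (\<lambda>q r. q \<otimes> r)) = carrier (S\<lparr>carrier := K\<rparr>)"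
    proof (intro equalityI subsetI)
      fix x
      assume "x \<in> (\<lambda>(r, g, q). r \<otimes> g \<otimes> q) `
        carrier (rees_semigroup (local_group S e) C W (\<lambda>q r. q \<otimes> r))"
      then obtain r g q where "r \<in> C" "g \<in> H" "q \<in> W" "x = r \<otimes> g \<otimes> q"
        by (auto simp: rees_semigroup_def)
      then show "x \<in> carrier (S\<lparr>carrier := K\<rparr>)"
        using C_subset_K kernel_ideal(2) by (simp add: mem_H mem_W subset_iff)
    next
      fix x
      assume "x \<in> carrier (S\<lparr>carrier := K\<rparr>)"
      then obtain r g q where "r \<in> C" "g \<in> H" "q \<in> W" "x = r \<otimes> g \<otimes> q"
        using kernel_decompose[of x] by auto
      then show "x \<in> (\<lambda>(r, g, q). r \<otimes> g \<otimes> q) `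
        carrier (rees_semigroup (local_group S e) C W (\<lambda>q r. q \<otimes> r))"
        by (auto simp: rees_semigroup_def intro!: image_eqI[of _ _ "(r, g, q)"])
    qed
  qed
qed

end

text \<open>Serves two purposes: with the identity on the group it replaces minimal ideals by the
  idempotents that represent them, and with the identity on the indices it replaces the semidirect
  product by \<open>\<G>\<close>.\<close>

lemma rees_semigroup_iso:
  assumes f: "bij_betw f I I'" and h: "bij_betw h \<Lambda> \<Lambda>'" and \<Phi>: "\<Phi> \<in> Group.iso G G'"
    and A: "\<And>l i. \<lbrakk>l \<in> \<Lambda>; i \<in> I\<rbrakk> \<Longrightarrow> A l i \<in> carrier G"
    and A': "\<And>l i. \<lbrakk>l \<in> \<Lambda>; i \<in> I\<rbrakk> \<Longrightarrow> A' (h l) (f i) = \<Phi> (A l i)"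
    and G: "\<And>x y. \<lbrakk>x \<in> carrier G; y \<in> carrier G\<rbrakk> \<Longrightarrow> x \<otimes>\<^bsub>G\<^esub> y \<in> carrier G"
  shows "rees_semigroup G I \<Lambda> A \<cong> rees_semigroup G' I' \<Lambda>' A'"
proof (intro is_isoI isoI)
  have \<Phi>': "\<Phi> \<in> hom G G'" "bij_betw \<Phi> (carrier G) (carrier G')"
    using \<Phi> by (auto simp: iso_def)
  let ?F = "map_prod f (map_prod \<Phi> h)"
  show "bij_betw ?F (carrier (rees_semigroup G I \<Lambda> A)) (carrier (rees_semigroup G' I' \<Lambda>' A'))"
    using f h \<Phi>' by (auto simp: rees_semigroup_def intro!: bij_betw_map_prod)
  show "?F \<in> hom (rees_semigroup G I \<Lambda> A) (rees_semigroup G' I' \<Lambda>' A')"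
    using f h \<Phi>' A A' G bij_betw_apply[OF f] bij_betw_apply[OF h] bij_betw_apply[OF \<Phi>'(2)]
    by (intro homI) (auto simp: rees_semigroup_def hom_mult)
qed

text \<open>
  The elements of both index sets at \<open>e\<close> are idempotents of \<open>S\<close>, hence the same for \<open>N\<close> as for \<open>S\<close>.
\<close>

lemma rees_iso_kernel_subsemigroup:
  assumes S: "group_idempotent S e" and N: "group_idempotent (S\<lparr>carrier := N\<rparr>) e"
    and sub: "N \<subseteq> carrier S" and idem: "\<And>p. idempotent_in S p \<Longrightarrow> p \<in> N"
  defines "M \<equiv> S\<lparr>carrier := semigroup_kernel (S\<lparr>carrier := N\<rparr>)\<rparr>"
  shows "rees_semigroup (local_group S e) (min_right_ideals M) (min_left_ideals M) (rees_matrix M e)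
    \<cong> S\<lparr>carrier := semigroup_kernel S\<rparr>"
    and "\<lbrakk>R \<in> min_right_ideals M; L \<in> min_left_ideals M\<rbrakk>
      \<Longrightarrow> rees_matrix M e L R \<in> carrier (local_group (S\<lparr>carrier := N\<rparr>) e)"
proof -
  interpret S: group_idempotent S e by (rule S)
  interpret N: group_idempotent "S\<lparr>carrier := N\<rparr>" e by (rule N)
  have C: "N.C = S.C" and W: "N.W = S.W"
    using sub idem S.idem_C S.idem_W
    by (auto simp: idempotent_column_def idempotent_row_def idempotent_in_def)
  have M: "M = S\<lparr>carrier := N, carrier := N.K\<rparr>"
    by (simp add: M_def)
  note col = N.bij_betw_column_ideal[folded M] and row = N.bij_betw_row_ideal[folded M]
  let ?f = "inv_into N.C N.column_ideal" and ?h = "inv_into N.W N.row_ideal"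
  have f: "?f R \<in> N.C" "N.column_ideal (?f R) = R" if "R \<in> min_right_ideals M" for R
    using that bij_betw_inv_into_right[OF col] bij_betw_apply[OF bij_betw_inv_into[OF col]] by auto
  have h: "?h L \<in> N.W" "N.row_ideal (?h L) = L" if "L \<in> min_left_ideals M" for L
    using that bij_betw_inv_into_right[OF row] bij_betw_apply[OF bij_betw_inv_into[OF row]] by auto
  have mat: "rees_matrix M e L R = ?h L \<otimes>\<^bsub>S\<^esub> ?f R" if "R \<in> min_right_ideals M" "L \<in> min_left_ideals M" for R L
    using N.rees_matrix_kernel[OF f(1) h(1), folded M] f(2) h(2) that by simp
  show "rees_matrix M e L R \<in> carrier (local_group (S\<lparr>carrier := N\<rparr>) e)"
    if "R \<in> min_right_ideals M" "L \<in> min_left_ideals M"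
    using N.sandwich_in_H[OF f(1) h(1)] mat that by simp
  have "rees_semigroup (local_group S e) (min_right_ideals M) (min_left_ideals M) (rees_matrix M e)
    \<cong> rees_semigroup (local_group S e) S.C S.W (\<lambda>q r. q \<otimes>\<^bsub>S\<^esub> r)"
  proof (rule rees_semigroup_iso)
    show "bij_betw ?f (min_right_ideals M) S.C" "bij_betw ?h (min_left_ideals M) S.W"
      using bij_betw_inv_into[OF col] bij_betw_inv_into[OF row] by (simp_all add: C W)
    show "(\<lambda>x. x) \<in> Group.iso (local_group S e) (local_group S e)"
      by (rule iso_set_refl)
    show "rees_matrix M e L R \<in> S.H" if "L \<in> min_left_ideals M" "R \<in> min_right_ideals M" for L R
      using S.sandwich_in_H f(1)[OF that(2)] h(1)[OF that(1)] mat[OF that(2,1)] by (simp add: C W)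
    show "?h L \<otimes>\<^bsub>S\<^esub> ?f R = rees_matrix M e L R" if "L \<in> min_left_ideals M" "R \<in> min_right_ideals M" for L R
      using mat[OF that(2,1)] by simp
    show "x \<otimes>\<^bsub>local_group S e\<^esub> y \<in> S.H" if "x \<in> S.H" "y \<in> S.H" for x y
      using S.mult_H[OF that] by (simp add: local_group_def)
  qed
  also have "\<dots> \<cong> S\<lparr>carrier := semigroup_kernel S\<rparr>"
    using S.rees_iso_kernel by (rule is_isoI)
  finally show "rees_semigroup (local_group S e) (min_right_ideals M) (min_left_ideals M)
    (rees_matrix M e) \<cong> S\<lparr>carrier := semigroup_kernel S\<rparr>" .
qed


section \<open>Split extensions\<close>

text \<open>Here \<open>\<phi> q\<close> is conjugation by \<open>s q\<close>, restricted because
  automorphisms are extensional functions. The isomorphism appears explicitly in the conclusion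
  because its values on pairs \<open>(n, 1)\<close> and its composite with \<open>p\<close> are used
  later.\<close>

lemma split_extension_semidirect:
  fixes G (structure) and Q (structure)
  assumes G: "group G" and Q: "group Q" and p: "p \<in> hom G Q" and s: "s \<in> hom Q G"
    and ps: "\<And>q. q \<in> carrier Q \<Longrightarrow> p (s q) = q"
  defines "N \<equiv> G\<lparr>carrier := kernel G Q p\<rparr>"
  obtains \<phi> where "\<phi> \<in> hom Q (AutoGroup N)"
    "(\<lambda>(n, q). n \<otimes>\<^bsub>G\<^esub> s q) \<in> Group.iso (semidirect_product N Q \<phi>) G"
proof -
  interpret G: group G by (rule G)
  interpret Q: group Q by (rule Q)
  interpret p: group_hom G Q p
    using p by unfold_locales
  interpret s: group_hom Q G s
    using s by unfold_locales
  have mem_N: "n \<in> carrier N \<longleftrightarrow> n \<in> carrier G \<and> p n = \<one>\<^bsub>Q\<^esub>" for n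
    by (auto simp: N_def kernel_def)
  have mult_N: "mult N = mult G"
    by (simp add: N_def)
  define \<phi> where "\<phi> q = (\<lambda>n\<in>carrier N. s q \<otimes>\<^bsub>G\<^esub> n \<otimes>\<^bsub>G\<^esub> inv\<^bsub>G\<^esub> s q)" for q
  have conj_N: "s q \<otimes>\<^bsub>G\<^esub> n \<otimes>\<^bsub>G\<^esub> inv\<^bsub>G\<^esub> s q \<in> carrier N" if "q \<in> carrier Q" "n \<in> carrier N" for q n
    using that by (simp add: mem_N ps)
  have conj_mult: "s q \<otimes>\<^bsub>G\<^esub> (s q' \<otimes>\<^bsub>G\<^esub> n \<otimes>\<^bsub>G\<^esub> inv\<^bsub>G\<^esub> s q') \<otimes>\<^bsub>G\<^esub> inv\<^bsub>G\<^esub> s q =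
      s (q \<otimes>\<^bsub>Q\<^esub> q') \<otimes>\<^bsub>G\<^esub> n \<otimes>\<^bsub>G\<^esub> inv\<^bsub>G\<^esub> s (q \<otimes>\<^bsub>Q\<^esub> q')"
    if "q \<in> carrier Q" "q' \<in> carrier Q" "n \<in> carrier G" for q q' n
    using that by (simp add: G.inv_mult_group G.m_assoc)
  have cancel: "inv\<^bsub>G\<^esub> s q \<otimes>\<^bsub>G\<^esub> (s q \<otimes>\<^bsub>G\<^esub> x) = x" if "q \<in> carrier Q" "x \<in> carrier G" for q x
    using that by (simp flip: G.m_assoc)
  have bij: "bij_betw (\<phi> q) (carrier N) (carrier N)" if q: "q \<in> carrier Q" for q
  proof (rule bij_betw_byWitness[where f' = "\<phi> (inv\<^bsub>Q\<^esub> q)"])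
    have "s \<one>\<^bsub>Q\<^esub> \<otimes>\<^bsub>G\<^esub> n \<otimes>\<^bsub>G\<^esub> inv\<^bsub>G\<^esub> s \<one>\<^bsub>Q\<^esub> = n" if "n \<in> carrier N" for n
      using that by (simp add: mem_N)
    then show "\<forall>n\<in>carrier N. \<phi> (inv\<^bsub>Q\<^esub> q) (\<phi> q n) = n" "\<forall>n\<in>carrier N. \<phi> q (\<phi> (inv\<^bsub>Q\<^esub> q) n) = n"
      using q conj_mult[of "inv\<^bsub>Q\<^esub> q" q] conj_mult[of q "inv\<^bsub>Q\<^esub> q"]
      by (auto simp: \<phi>_def conj_N) (simp_all add: mem_N)
    show "\<phi> q ` carrier N \<subseteq> carrier N" "\<phi> (inv\<^bsub>Q\<^esub> q) ` carrier N \<subseteq> carrier N"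
      using q conj_N[of q] conj_N[of "inv\<^bsub>Q\<^esub> q"] by (auto simp: \<phi>_def)
  qed
  have hom_\<phi>: "\<phi> q \<in> hom N N" if q: "q \<in> carrier Q" for q
  proof (rule homI)
    show "\<phi> q n \<in> carrier N" if "n \<in> carrier N" for n
      using that q conj_N by (simp add: \<phi>_def)
    show "\<phi> q (m \<otimes>\<^bsub>N\<^esub> n) = \<phi> q m \<otimes>\<^bsub>N\<^esub> \<phi> q n" if "m \<in> carrier N" "n \<in> carrier N" for m n
    proof -
      have mn: "m \<in> carrier G" "n \<in> carrier G" "m \<otimes>\<^bsub>G\<^esub> n \<in> carrier N"
        using that by (auto simp: mem_N)
      show ?thesis
        using q mn that by (simp add: \<phi>_def mult_N G.m_assoc cancel)
    qed
  qed
  have aut: "\<phi> q \<in> auto N" if "q \<in> carrier Q" for q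
    using hom_\<phi> bij that by (auto simp: auto_def Bij_def \<phi>_def)
  have "\<phi> \<in> hom Q (AutoGroup N)"
  proof (rule homI)
    show "\<phi> q \<in> carrier (AutoGroup N)" if "q \<in> carrier Q" for q
      using aut that by (simp add: AutoGroup_def)
    show "\<phi> (q \<otimes>\<^bsub>Q\<^esub> q') = \<phi> q \<otimes>\<^bsub>AutoGroup N\<^esub> \<phi> q'" if "q \<in> carrier Q" "q' \<in> carrier Q" for q q'
    proof -
      have "\<phi> (q \<otimes>\<^bsub>Q\<^esub> q') = compose (carrier N) (\<phi> q) (\<phi> q')"
        using that conj_mult conj_N unfolding compose_def \<phi>_def
        by (intro restrict_ext) (simp add: mem_N)
      then show ?thesis
        using aut that by (simp add: AutoGroup_def BijGroup_def auto_def)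
    qed
  qed
  moreover have "(\<lambda>(n, q). n \<otimes>\<^bsub>G\<^esub> s q) \<in> Group.iso (semidirect_product N Q \<phi>) G"
  proof (rule isoI)
    show "(\<lambda>(n, q). n \<otimes>\<^bsub>G\<^esub> s q) \<in> hom (semidirect_product N Q \<phi>) G"
    proof (rule homI; clarsimp simp: semidirect_product_def mult_N)
      show "n \<otimes>\<^bsub>G\<^esub> s q \<in> carrier G" if "n \<in> carrier N" "q \<in> carrier Q" for n q
        using that by (simp add: mem_N)
      show "n \<otimes>\<^bsub>G\<^esub> \<phi> q n' \<otimes>\<^bsub>G\<^esub> (s q \<otimes>\<^bsub>G\<^esub> s q') = n \<otimes>\<^bsub>G\<^esub> s q \<otimes>\<^bsub>G\<^esub> (n' \<otimes>\<^bsub>G\<^esub> s q')"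
        if n: "n \<in> carrier N" "n' \<in> carrier N" and q: "q \<in> carrier Q" "q' \<in> carrier Q" for n n' q q'
      proof -
        have nG: "n \<in> carrier G" "n' \<in> carrier G"
          using n by (auto simp: mem_N)
        show ?thesis
          using q nG n by (simp add: \<phi>_def G.m_assoc cancel)
      qed
    qed
    have "bij_betw (\<lambda>(n, q). n \<otimes>\<^bsub>G\<^esub> s q) (carrier N \<times> carrier Q) (carrier G)"
    proof (rule bij_betw_byWitness[where f' = "\<lambda>g. (g \<otimes>\<^bsub>G\<^esub> inv\<^bsub>G\<^esub> s (p g), p g)"])
    qed (auto simp: mem_N ps G.m_assoc)
    then show "bij_betw (\<lambda>(n, q). n \<otimes>\<^bsub>G\<^esub> s q) (carrier (semidirect_product N Q \<phi>)) (carrier G)"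
      by (simp add: semidirect_product_def)
  qed
  ultimately show thesis
    by (rule that)
qed


section \<open>The Ellis semigroup and equicontinuous factors\<close>

locale compact_dynamics =
  fixes T :: "('t, 'b) monoid_scheme" and \<sigma> :: "'t \<Rightarrow> 'x \<Rightarrow> 'x::metric_space"
  assumes dynamics: "dynamical_system T \<sigma>"
begin

abbreviation "E \<equiv> carrier (ellis T \<sigma>)"

sublocale T: comm_group T
  using dynamics by (simp add: dynamical_system_def)

lemma act_cont: "t \<in> carrier T \<Longrightarrow> continuous_on UNIV (\<sigma> t)"
  using dynamics by (simp add: dynamical_system_def)

lemma act_action: "group_action T UNIV \<sigma>"
  using dynamics by (simp add: dynamical_system_def)

lemma act_mult: "\<lbrakk>s \<in> carrier T; t \<in> carrier T\<rbrakk> \<Longrightarrow> \<sigma> (s \<otimes>\<^bsub>T\<^esub> t) = \<sigma> s \<circ> \<sigma> t"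
  using group_action.composition_rule[OF act_action] by (auto simp: fun_eq_iff)

lemma act_one: "\<sigma> \<one>\<^bsub>T\<^esub> = id"
  using group_action.id_eq_one[OF act_action] by (simp add: fun_eq_iff)

lemma act_inv: "t \<in> carrier T \<Longrightarrow> \<sigma> (inv\<^bsub>T\<^esub> t) \<circ> \<sigma> t = id" "t \<in> carrier T \<Longrightarrow> \<sigma> t \<circ> \<sigma> (inv\<^bsub>T\<^esub> t) = id"
  using act_mult[of "inv\<^bsub>T\<^esub> t" t] act_mult[of t "inv\<^bsub>T\<^esub> t"] act_one by auto

lemma act_commute: "\<lbrakk>s \<in> carrier T; t \<in> carrier T\<rbrakk> \<Longrightarrow> \<sigma> s \<circ> \<sigma> t = \<sigma> t \<circ> \<sigma> s"
  by (metis act_mult T.m_comm)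

lemma act_in_E: "t \<in> carrier T \<Longrightarrow> \<sigma> t \<in> E"
  unfolding ellis_def using closure_subset by fastforce

text \<open>Density of the \<open>\<sigma> t\<close>, packaged as a rule. Evaluation at a point is
  continuous on the function space, so equations and non-strict inequalities between continuous
  functions of the values qualify.\<close>

lemma E_closed_induct:
  assumes "f \<in> E" "closed {f. P f}" "\<And>t. t \<in> carrier T \<Longrightarrow> P (\<sigma> t)"
  shows "P f"
proof -
  have "closure (\<sigma> ` carrier T) \<subseteq> {f. P f}"
    using assms(2,3) by (intro closure_minimal) auto
  then show ?thesis
    using assms(1) by (auto simp: ellis_def)
qed

lemma E_comp: "\<lbrakk>f \<in> E; g \<in> E\<rbrakk> \<Longrightarrow> f \<circ> g \<in> E"
  unfolding ellis_def partial_object.simps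
proof (rule closure_comp_closed)
  fix f g
  assume "f \<in> \<sigma> ` carrier T" "g \<in> \<sigma> ` carrier T"
  then obtain s t where "s \<in> carrier T" "t \<in> carrier T" "f = \<sigma> s" "g = \<sigma> t"
    by blast
  then show "f \<circ> g \<in> \<sigma> ` carrier T"
    using act_mult[of s t] by (intro image_eqI[of _ _ "s \<otimes>\<^bsub>T\<^esub> t"]) auto
qed (use act_cont in auto)

lemma id_in_E: "id \<in> E"
  using act_in_E[OF T.one_closed] act_one by simp

lemma monoid_ellis: "monoid (ellis T \<sigma>)"
  using E_comp id_in_E by (intro monoidI) (auto simp: ellis_def o_assoc)

lemma compact_E: "compact E"
proof -
  have "compact (UNIV :: 'x set)"
    using dynamics by (simp add: dynamical_system_def)
  then have "compact (UNIV \<inter> closure (\<sigma> ` carrier T))"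
    by (intro compact_Int_closed compact_UNIV_fun closed_closure)
  then show ?thesis
    by (simp add: ellis_def)
qed

lemma E_commute:
  assumes "f \<in> E" "t \<in> carrier T"
  shows "f (\<sigma> t x) = \<sigma> t (f x)"
proof (rule E_closed_induct[OF assms(1)])
  show "closed {f. f (\<sigma> t x) = \<sigma> t (f x)}"
    by (intro closed_Collect_eq continuous_on_eval_comp[OF act_cont[OF assms(2)]]
        continuous_on_product_coordinates)
  show "\<sigma> s (\<sigma> t x) = \<sigma> t (\<sigma> s x)" if "s \<in> carrier T" for s
    using act_commute[OF that assms(2)] by (simp add: fun_eq_iff)
qed

text \<open>Evaluation at \<open>x\<close> maps the compact set \<open>E\<close> onto a closed set,
  and this set contains the dense orbit of \<open>x\<close>.\<close>

lemma E_transitive: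
  assumes "closure (orbit T \<sigma> x) = UNIV"
  obtains f where "f \<in> E" "f x = y"
proof -
  have "compact ((\<lambda>f. f x) ` E)"
    by (intro compact_continuous_image compact_E continuous_on_subset[OF continuous_on_product_coordinates]) auto
  then have "closed ((\<lambda>f. f x) ` E)"
    by (rule compact_imp_closed)
  moreover have "orbit T \<sigma> x \<subseteq> (\<lambda>f. f x) ` E"
    using act_in_E by (auto simp: orbit_def)
  ultimately have "closure (orbit T \<sigma> x) \<subseteq> (\<lambda>f. f x) ` E"
    by (intro closure_minimal)
  then have "y \<in> (\<lambda>f. f x) ` E"
    using assms by auto
  then show thesis
    by (elim imageE) (rule that, simp_all)
qed

end

section \<open>The Ellis semigroup of a minimal equicontinuous system as a topological group
  structure on Y\<close>

locale equicontinuous_minimal =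
  fixes T :: "('t, 'b) monoid_scheme" and \<delta> :: "'t \<Rightarrow> 'y \<Rightarrow> 'y::metric_space" and y0 :: 'y
  assumes equicontinuous: "equicontinuous_system T \<delta>" and minimal: "minimal_system T \<delta>"
begin

sublocale compact_dynamics T \<delta>
  using equicontinuous by unfold_locales (simp add: equicontinuous_system_def)

lemma E_equicontinuous:
  assumes "\<epsilon> > 0"
  obtains d where "d > 0" "\<And>z f. \<lbrakk>dist z y < d; f \<in> E\<rbrakk> \<Longrightarrow> dist (f z) (f y) \<le> \<epsilon>"
proof -
  obtain d where d: "d > 0" "\<And>z t. \<lbrakk>dist z y < d; t \<in> carrier T\<rbrakk> \<Longrightarrow> dist (\<delta> t z) (\<delta> t y) < \<epsilon>"
    using equicontinuous assms unfolding equicontinuous_system_def by meson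
  \<comment> \<open>The bound becomes non-strict because only then is it a closed condition on
    \<open>f\<close>.\<close>
  have "dist (f z) (f y) \<le> \<epsilon>" if "dist z y < d" "f \<in> E" for z f
  proof (rule E_closed_induct[OF that(2)])
    show "closed {f. dist (f z) (f y) \<le> \<epsilon>}"
      by (intro closed_Collect_le continuous_intros continuous_on_product_coordinates)
  qed (use d that in \<open>auto intro: less_imp_le\<close>)
  with d show thesis
    using that by blast
qed

lemma E_cont:
  assumes "f \<in> E"
  shows "continuous_on UNIV f"
  unfolding continuous_on_iff
proof (intro ballI allI impI)
  fix y :: 'y and \<epsilon> :: real
  assume "\<epsilon> > 0"
  then obtain d where "d > 0" "\<And>z f. \<lbrakk>dist z y < d; f \<in> E\<rbrakk> \<Longrightarrow> dist (f z) (f y) \<le> \<epsilon> / 2"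
    using E_equicontinuous[of "\<epsilon> / 2" y] by auto
  then show "\<exists>d>0. \<forall>z\<in>UNIV. dist z y < d \<longrightarrow> dist (f z) (f y) < \<epsilon>"
    using assms \<open>\<epsilon> > 0\<close> by (intro exI[of _ d]) fastforce
qed

text \<open>Equicontinuity enters through the continuity of \<open>f\<close>, which makes the
  condition closed in \<open>g\<close>.\<close>

lemma E_abelian:
  assumes "f \<in> E" "g \<in> E"
  shows "f (g y) = g (f y)"
proof (rule E_closed_induct[OF assms(2)])
  show "closed {g. f (g y) = g (f y)}"
    by (intro closed_Collect_eq continuous_on_eval_comp[OF E_cont[OF assms(1)]]
        continuous_on_product_coordinates)
  show "f (\<delta> t y) = \<delta> t (f y)" if "t \<in> carrier T" for t
    using E_commute[OF assms(1) that] .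
qed

lemma E_transitive': obtains f where "f \<in> E" "f y = z"
  using E_transitive[of y z] minimal by (auto simp: minimal_system_def)

text \<open>A commutative transitive action is free: with \<open>z = h y\<close> one gets
  \<open>f z = h (f y) = h (g y) = g z\<close>.\<close>

lemma E_eqI:
  assumes "f \<in> E" "g \<in> E" "f y = g y"
  shows "f = g"
proof
  fix z
  obtain h where "h \<in> E" "h y = z"
    by (rule E_transitive')
  then show "f z = g z"
    using assms E_abelian by metis
qed

text \<open>Evaluation at \<open>y0\<close> identifies the Ellis semigroup of Y with Y itself, and
  \<open>transl y\<close> is the element belonging to \<open>y\<close>. Read as a binary operation,
  \<open>transl\<close> is composition carried over to Y, hence the group law.\<close>

definition transl :: "'y \<Rightarrow> 'y \<Rightarrow> 'y" where
  "transl y = (SOME f. f \<in> E \<and> f y0 = y)"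

lemma transl: "transl y \<in> E" "transl y y0 = y"
proof -
  have "\<exists>f. f \<in> E \<and> f y0 = y"
    using E_transitive' by metis
  from someI_ex[OF this] show "transl y \<in> E" "transl y y0 = y"
    by (simp_all add: transl_def)
qed

lemma transl_eqI: "\<lbrakk>f \<in> E; f y0 = y\<rbrakk> \<Longrightarrow> transl y = f"
  using E_eqI[OF transl(1), of f y y0] transl(2) by simp

lemma transl_commute: "transl y z = transl z y"
  using E_abelian[OF transl(1) transl(1), of y z y0] by (simp add: transl)

definition transl_group :: "'y monoid" where
  "transl_group = \<lparr>carrier = UNIV, mult = transl, one = y0\<rparr>"

lemma transl_comm_group: "comm_group transl_group"
proof (rule comm_groupI)
  fix x y z
  have "transl (transl x y) = transl x \<circ> transl y"
    using E_comp[OF transl(1) transl(1), of x y] by (intro transl_eqI) (auto simp: transl)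
  then show "x \<otimes>\<^bsub>transl_group\<^esub> y \<otimes>\<^bsub>transl_group\<^esub> z = x \<otimes>\<^bsub>transl_group\<^esub> (y \<otimes>\<^bsub>transl_group\<^esub> z)"
    by (simp add: transl_group_def)
  show "x \<otimes>\<^bsub>transl_group\<^esub> y = y \<otimes>\<^bsub>transl_group\<^esub> x"
    by (simp add: transl_group_def transl_commute)
  have "transl y0 = id"
    using id_in_E by (intro transl_eqI) auto
  then show "\<one>\<^bsub>transl_group\<^esub> \<otimes>\<^bsub>transl_group\<^esub> x = x"
    by (simp add: transl_group_def)
  \<comment> \<open>Since \<open>f = transl (f y0)\<close>, the point \<open>f y0\<close> is the
    inverse of \<open>x\<close>.\<close>
  obtain f where f: "f \<in> E" "f x = y0"
    by (rule E_transitive')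
  then have "transl (f y0) x = y0"
    using transl_eqI[OF f(1) refl] by simp
  then show "\<exists>y\<in>carrier transl_group. y \<otimes>\<^bsub>transl_group\<^esub> x = \<one>\<^bsub>transl_group\<^esub>"
    by (auto simp: transl_group_def)
qed (auto simp: transl_group_def)

lemma transl_cont: "continuous_on UNIV (\<lambda>(y, z). transl y z)"
  unfolding continuous_on_iff
proof (intro ballI allI impI)
  fix yz :: "'y \<times> 'y" and \<epsilon> :: real
  assume "\<epsilon> > 0"
  obtain y z where yz: "yz = (y, z)"
    by fastforce
  obtain d1 where d1: "d1 > 0" "\<And>w f. \<lbrakk>dist w y < d1; f \<in> E\<rbrakk> \<Longrightarrow> dist (f w) (f y) \<le> \<epsilon> / 4"
    using E_equicontinuous[of "\<epsilon> / 4" y] \<open>\<epsilon> > 0\<close> by auto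
  obtain d2 where d2: "d2 > 0" "\<And>w f. \<lbrakk>dist w z < d2; f \<in> E\<rbrakk> \<Longrightarrow> dist (f w) (f z) \<le> \<epsilon> / 4"
    using E_equicontinuous[of "\<epsilon> / 4" z] \<open>\<epsilon> > 0\<close> by auto
  have "dist (transl y' z') (transl y z) < \<epsilon>" if "dist (y', z') (y, z) < min d1 d2" for y' z'
  proof -
    have "dist y' y < d1" "dist z' z < d2"
      using that dist_fst_le[of "(y', z')" "(y, z)"] dist_snd_le[of "(y', z')" "(y, z)"] by auto
    \<comment> \<open>In the second bound commutativity turns the varying first argument into the
      argument of the single map \<open>transl z\<close>, so that equicontinuity at \<open>y\<close>
      applies.\<close>
    then have "dist (transl y' z') (transl y' z) \<le> \<epsilon> / 4" "dist (transl y' z) (transl y z) \<le> \<epsilon> / 4"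
      using d1(2) d2(2) transl(1) transl_commute by metis+
    then show ?thesis
      using dist_triangle[of "transl y' z'" "transl y z" "transl y' z"] \<open>\<epsilon> > 0\<close> by linarith
  qed
  then show "\<exists>d>0. \<forall>x'\<in>UNIV. dist x' yz < d \<longrightarrow>
      dist (case x' of (y, z) \<Rightarrow> transl y z) (case yz of (y, z) \<Rightarrow> transl y z) < \<epsilon>"
    using d1(1) d2(1) by (intro exI[of _ "min d1 d2"]) (auto simp: yz)
qed

lemma transl_inv_cont: "continuous_on UNIV (\<lambda>y. inv\<^bsub>transl_group\<^esub> y)"
  unfolding continuous_on_iff
proof (intro ballI allI impI)
  interpret Q: comm_group transl_group
    by (rule transl_comm_group)
  let ?i = "\<lambda>y. inv\<^bsub>transl_group\<^esub> y"
  have mem: "x \<in> carrier transl_group" for x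
    by (simp add: transl_group_def)
  fix y :: 'y and \<epsilon> :: real
  assume "\<epsilon> > 0"
  then obtain d where d: "d > 0" "\<And>z f. \<lbrakk>dist z y < d; f \<in> E\<rbrakk> \<Longrightarrow> dist (f z) (f y) \<le> \<epsilon> / 2"
    using E_equicontinuous[of "\<epsilon> / 2" y] by auto
  have "dist (?i z) (?i y) < \<epsilon>" if "dist z y < d" for z
  proof -
    \<comment> \<open>Additively, \<open>w = - z - y\<close>. Translation by \<open>w\<close> sends
      \<open>z\<close> to \<open>- y\<close> and \<open>y\<close> to \<open>- z\<close>, so
      equicontinuity at \<open>y\<close> bounds the distance of the inverses.\<close>
    define w where "w = ?i z \<otimes>\<^bsub>transl_group\<^esub> ?i y"
    have "w \<otimes>\<^bsub>transl_group\<^esub> z = ?i y" "w \<otimes>\<^bsub>transl_group\<^esub> y = ?i z"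
      using mem by (simp_all add: w_def Q.m_ac)
        (metis Q.inv_closed Q.m_assoc Q.m_comm Q.r_inv Q.r_one mem)+
    then have "dist (?i y) (?i z) \<le> \<epsilon> / 2"
      using d(2)[OF that transl(1), of w] by (simp add: transl_group_def)
    then show ?thesis
      using \<open>\<epsilon> > 0\<close> by (simp add: dist_commute)
  qed
  then show "\<exists>d>0. \<forall>z\<in>UNIV. dist z y < d \<longrightarrow> dist (?i z) (?i y) < \<epsilon>"
    using d(1) by blast
qed

lemma act_transl: "t \<in> carrier T \<Longrightarrow> \<delta> t y = transl y (\<delta> t y0)"
  using E_commute[OF transl(1), of t y y0] by (simp add: transl)

lemma factor_group_eq: "factor_group T \<delta> y0 = transl_group"
proof -
  have "(THE m. let Q = \<lparr>carrier = UNIV, mult = m, one = y0\<rparr> in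
          comm_group Q \<and>
          continuous_on UNIV (\<lambda>(y, z). m y z) \<and>
          continuous_on UNIV (\<lambda>y. inv\<^bsub>Q\<^esub> y) \<and>
          (\<forall>t\<in>carrier T. \<forall>y. \<delta> t y = m y (\<delta> t y0))) = transl"
  proof (rule the_equality, goal_cases)
    case 1
    then show ?case
      unfolding Let_def transl_group_def[symmetric]
      by (intro conjI ballI allI transl_comm_group transl_cont transl_inv_cont) (rule act_transl)
  next
    case (2 m)
    then have cont: "continuous_on UNIV (\<lambda>(y, z). m y z)"
      and m: "\<And>t y. t \<in> carrier T \<Longrightarrow> \<delta> t y = m y (\<delta> t y0)"
      unfolding Let_def by blast+
    have slice: "continuous_on UNIV (k y)" if "continuous_on UNIV (\<lambda>(y, z). k y z)"
      for k :: "'y \<Rightarrow> 'y \<Rightarrow> 'y" and y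
      using continuous_on_compose2[OF that continuous_on_Pair[OF continuous_on_const[of UNIV y] continuous_on_id]]
      by simp
    show ?case
    proof (intro ext)
      fix y z
      have "closed {z. m y z = transl y z}"
        by (intro closed_Collect_eq slice cont transl_cont)
      then have "closure (orbit T \<delta> y0) \<subseteq> {z. m y z = transl y z}"
        by (intro closure_minimal) (auto simp: orbit_def simp flip: m act_transl)
      then show "m y z = transl y z"
        using minimal by (auto simp: minimal_system_def)
    qed
  qed
  then show ?thesis
    by (simp add: factor_group_def transl_group_def)
qed

lemma comm_group_factor_group: "comm_group (factor_group T \<delta> y0)"
  and carrier_factor_group: "carrier (factor_group T \<delta> y0) = UNIV"
  and one_factor_group: "\<one>\<^bsub>factor_group T \<delta> y0\<^esub> = y0"
  and mult_factor_group_cont: "continuous_on UNIV (mult (factor_group T \<delta> y0) y)"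
  unfolding factor_group_eq
  using transl_comm_group E_cont[OF transl(1)] by (simp_all add: transl_group_def)

lemma act_factor_group: "t \<in> carrier T \<Longrightarrow> \<delta> t y = y \<otimes>\<^bsub>factor_group T \<delta> y0\<^esub> \<delta> t y0"
  unfolding factor_group_eq transl_group_def monoid.simps by (rule act_transl)

end


section \<open>Factors all of whose covariant fibre maps are in the Ellis semigroup\<close>

locale cov_extension = X: compact_dynamics T \<sigma> + Y: equicontinuous_minimal T \<delta> y0
  for T :: "('t, 'b) monoid_scheme"
    and \<sigma> :: "'t \<Rightarrow> 'x \<Rightarrow> 'x::metric_space"
    and \<delta> :: "'t \<Rightarrow> 'y \<Rightarrow> 'y::metric_space"
    and y0 :: 'y +
  fixes p :: "'x \<Rightarrow> 'y" and e :: "'x \<Rightarrow> 'x"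
  assumes minimal: "minimal_system T \<sigma>"
    and factor: "factor_map T \<sigma> \<delta> p"
    and cov: "fibre_restrictions p ` carrier (ellis_fib T \<sigma> p y0) = Cov T \<sigma> \<delta> p y0"
    and min_idem: "minimal_idempotent (ellis T \<sigma>) e"
begin

abbreviation "E \<equiv> X.E"
abbreviation "Efib \<equiv> carrier (ellis_fib T \<sigma> p y0)"
abbreviation "Q \<equiv> factor_group T \<delta> y0"
abbreviation "\<pi> \<equiv> induced p y0"
abbreviation "\<G> \<equiv> local_group (ellis T \<sigma>) e"
abbreviation "\<G>fib \<equiv> local_group (ellis_fib T \<sigma> p y0) e"
abbreviation "G \<equiv> carrier \<G>"
abbreviation "Gfib \<equiv> carrier \<G>fib"

sublocale Q: comm_group Q
  by (rule Y.comm_group_factor_group)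

lemma Q_UNIV [simp]: "y \<in> carrier Q"
  by (simp add: Y.carrier_factor_group)

lemma Q_one: "\<one>\<^bsub>Q\<^esub> = y0"
  by (rule Y.one_factor_group)

lemma mult_ellis: "mult (ellis T \<sigma>) = (\<circ>)" and mult_ellis_fib: "mult (ellis_fib T \<sigma> p y0) = (\<circ>)"
  by (simp_all add: ellis_def ellis_fib_def)

lemma p_cont: "continuous_on UNIV p" and p_surj: "surj p"
  and p_act: "t \<in> carrier T \<Longrightarrow> p (\<sigma> t x) = \<delta> t (p x)"
  using factor by (auto simp: factor_map_def)

lemma base_point: "p (SOME x. p x = y0) = y0"
  using p_surj by (metis (mono_tags, lifting) someI surjD)

text \<open>For \<open>f = \<sigma> t\<close> this is the relation between \<open>\<delta> t\<close>
  and the group law of Y, and both sides depend continuously on \<open>f\<close>.\<close>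

lemma p_E:
  assumes "f \<in> E"
  shows "p (f x) = p x \<otimes>\<^bsub>Q\<^esub> \<pi> f"
  unfolding induced_def
proof (rule X.E_closed_induct[OF assms])
  have "continuous_on UNIV (\<lambda>x'. p x \<otimes>\<^bsub>Q\<^esub> p x')"
    using continuous_on_compose2[OF Y.mult_factor_group_cont p_cont] by simp
  then show "closed {f. p (f x) = p x \<otimes>\<^bsub>Q\<^esub> p (f (SOME x. p x = y0))}"
    by (intro closed_Collect_eq continuous_on_eval_comp p_cont)
  show "p (\<sigma> t x) = p x \<otimes>\<^bsub>Q\<^esub> p (\<sigma> t (SOME x. p x = y0))" if "t \<in> carrier T" for t
    unfolding p_act[OF that] base_point by (rule Y.act_factor_group[OF that])
qed

lemma induced_comp:
  assumes "f \<in> E" "g \<in> E"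
  shows "\<pi> (f \<circ> g) = \<pi> f \<otimes>\<^bsub>Q\<^esub> \<pi> g"
proof -
  have "\<pi> (f \<circ> g) = \<pi> g \<otimes>\<^bsub>Q\<^esub> \<pi> f"
    using p_E[OF assms(1), of "g (SOME x. p x = y0)"] by (simp add: induced_def)
  then show ?thesis
    using Q.m_comm[of "\<pi> g" "\<pi> f"] by simp
qed

lemma induced_act: "t \<in> carrier T \<Longrightarrow> \<pi> (\<sigma> t) = \<delta> t y0"
  by (simp add: induced_def p_act base_point)

lemma act_mult_Q:
  assumes "t \<in> carrier T"
  shows "\<delta> t (y \<otimes>\<^bsub>Q\<^esub> z) = \<delta> t y \<otimes>\<^bsub>Q\<^esub> z"
  using Y.act_factor_group[OF assms, of "y \<otimes>\<^bsub>Q\<^esub> z"] Y.act_factor_group[OF assms, of y]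
  by (simp add: Q.m_ac)

lemma Efib_iff: "f \<in> Efib \<longleftrightarrow> f \<in> E \<and> \<pi> f = y0"
  by (auto simp: ellis_fib_def)

lemma p_Efib: "f \<in> Efib \<Longrightarrow> p (f x) = p x"
  using p_E[of f x] Q.r_one[of "p x"] by (simp add: Efib_iff Q_one)

lemma EfibI: "\<lbrakk>f \<in> E; \<And>x. p (f x) = p x\<rbrakk> \<Longrightarrow> f \<in> Efib"
  by (simp add: Efib_iff induced_def base_point)

text \<open>The map \<open>\<pi>\<close> is multiplicative, and a group has only one
  idempotent.\<close>

lemma idempotent_in_Efib:
  assumes "idempotent_in (ellis T \<sigma>) u"
  shows "u \<in> Efib"
proof -
  have "u \<in> E" "\<pi> u \<otimes>\<^bsub>Q\<^esub> \<pi> u = \<pi> u"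
    using assms induced_comp[of u u] by (auto simp: idempotent_in_def mult_ellis)
  then show ?thesis
    using Q.l_cancel_one[of "\<pi> u" "\<pi> u"] by (simp add: Efib_iff Q_one)
qed

lemma Efib_comp: "\<lbrakk>f \<in> Efib; g \<in> Efib\<rbrakk> \<Longrightarrow> f \<circ> g \<in> Efib"
  by (rule EfibI) (simp_all add: p_Efib X.E_comp Efib_iff[THEN iffD1])

lemma monoid_ellis_fib: "monoid (ellis_fib T \<sigma> p y0)"
proof -
  have "id \<in> Efib"
    using X.id_in_E by (rule EfibI) simp
  moreover have "one (ellis_fib T \<sigma> p y0) = id"
    by (simp add: ellis_fib_def ellis_def)
  ultimately show ?thesis
    using Efib_comp by (intro monoidI) (auto simp: mult_ellis_fib o_assoc)
qed

lemma compact_Efib: "compact Efib"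
proof -
  have "closed {f :: 'x \<Rightarrow> 'x. \<forall>x. p (f x) = p x}"
    by (intro closed_Collect_all closed_Collect_eq continuous_on_eval_comp p_cont continuous_on_const)
  moreover have "Efib = E \<inter> {f. \<forall>x. p (f x) = p x}"
    using p_Efib EfibI Efib_iff by blast
  ultimately show ?thesis
    using compact_Int_closed[OF X.compact_E] by simp
qed

lemma min_idem_fib: "minimal_idempotent (ellis_fib T \<sigma> p y0) e"
proof -
  have "idempotent_in (ellis_fib T \<sigma> p y0) u \<longleftrightarrow> idempotent_in (ellis T \<sigma>) u" for u
    using idempotent_in_Efib[of u] Efib_iff[of u]
    by (auto simp: idempotent_in_def mult_ellis mult_ellis_fib)
  then show ?thesis
    using min_idem by (simp add: minimal_idempotent_def mult_ellis mult_ellis_fib)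
qed

section \<open>The structure groups and the projection to Y\<close>

sublocale S: group_idempotent "ellis T \<sigma>" e
proof (intro group_idempotent.intro group_idempotent_axioms.intro X.monoid_ellis)
  show "group \<G>"
    by (rule group_local_group_minimal[OF X.compact_E mult_ellis X.E_comp min_idem])
  show "idempotent_in (ellis T \<sigma>) e"
    using min_idem by (simp add: minimal_idempotent_def)
qed

sublocale F: group_idempotent "ellis_fib T \<sigma> p y0" e
proof (intro group_idempotent.intro group_idempotent_axioms.intro monoid_ellis_fib)
  show "group \<G>fib"
    by (rule group_local_group_minimal[OF compact_Efib mult_ellis_fib Efib_comp min_idem_fib])
  show "idempotent_in (ellis_fib T \<sigma> p y0) e"
    using min_idem_fib by (simp add: minimal_idempotent_def)
qed

sublocale \<G>: group \<G>
  by (rule S.local_group)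

lemma mem_G: "f \<in> G \<longleftrightarrow> f \<in> E \<and> e \<circ> f = f \<and> f \<circ> e = f"
  using S.mem_H by (simp add: mult_ellis)

lemma mem_Gfib: "f \<in> Gfib \<longleftrightarrow> f \<in> G \<and> \<pi> f = y0"
  unfolding mem_G using F.mem_H by (auto simp: mult_ellis_fib Efib_iff)

lemma mult_\<G>: "mult \<G> = (\<circ>)" and mult_\<G>fib: "mult \<G>fib = (\<circ>)" and one_\<G>: "\<one>\<^bsub>\<G>\<^esub> = e"
  by (simp_all add: local_group_def mult_ellis mult_ellis_fib)

lemma e_Efib: "e \<in> Efib"
  using F.e_closed .

lemma p_e [simp]: "p (e x) = p x"
  using p_Efib[OF e_Efib] .

lemma e_e [simp]: "e (e x) = e x"
  using S.ee by (metis comp_apply mult_ellis)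

lemma G_E: "f \<in> G \<Longrightarrow> f \<in> E"
  by (simp add: mem_G)

lemma G_e: "f \<in> G \<Longrightarrow> e (f x) = f x" "f \<in> G \<Longrightarrow> f (e x) = f x"
  by (simp_all add: mem_G fun_eq_iff)

lemma G_comp: "\<lbrakk>f \<in> G; g \<in> G\<rbrakk> \<Longrightarrow> f \<circ> g \<in> G"
  using \<G>.m_closed by (simp add: mult_\<G>)

lemma G_inv:
  assumes "f \<in> G"
  shows "inv\<^bsub>\<G>\<^esub> f \<in> G" "f ((inv\<^bsub>\<G>\<^esub> f) x) = e x" "(inv\<^bsub>\<G>\<^esub> f) (f x) = e x"
  using \<G>.inv_closed[OF assms] \<G>.r_inv[OF assms] \<G>.l_inv[OF assms]
  by (auto simp: mult_\<G> one_\<G> fun_eq_iff)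

lemma induced_hom: "\<pi> \<in> hom \<G> Q"
  by (rule homI) (simp_all add: mult_\<G> induced_comp G_E)

sublocale \<pi>: group_hom \<G> Q \<pi>
  using induced_hom by unfold_locales

lemma induced_inv: "f \<in> G \<Longrightarrow> \<pi> (inv\<^bsub>\<G>\<^esub> f) = inv\<^bsub>Q\<^esub> \<pi> f"
  by (rule \<pi>.hom_inv)

lemma kernel_induced: "kernel \<G> Q \<pi> = Gfib"
  by (auto simp: kernel_def mem_Gfib Q_one)

lemma \<G>fib_eq: "\<G>fib = \<G>\<lparr>carrier := kernel \<G> Q \<pi>\<rparr>"
  unfolding kernel_induced by (simp add: local_group_def mult_ellis mult_ellis_fib)

text \<open>Minimality of X makes \<open>E\<close> transitive, so some \<open>f\<close> in
  \<open>E\<close> lies over \<open>z\<close>; passing to \<open>e f e\<close> keeps its image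
  because \<open>\<pi> e\<close> is the identity of Y.\<close>

lemma induced_surj_G: "\<exists>f. f \<in> G \<and> \<pi> f = z"
proof -
  obtain x where x: "p x = z"
    using p_surj by (metis surjD)
  obtain f where f: "f \<in> E" "f (SOME x. p x = y0) = x"
    using X.E_transitive minimal by (auto simp: minimal_system_def)
  have fz: "\<pi> f = z"
    using x f by (simp add: induced_def)
  have eE: "e \<in> E" "\<pi> e = \<one>\<^bsub>Q\<^esub>"
    using e_Efib by (auto simp: Efib_iff Q_one)
  have "e \<circ> f \<circ> e \<in> G"
    using eE f by (auto simp: mem_G X.E_comp fun_eq_iff)
  moreover have "\<pi> (e \<circ> f \<circ> e) = z"
    using eE f fz by (simp add: induced_comp X.E_comp)
  ultimately show ?thesis
    by blast
qed

text \<open>The hypothesis on \<open>Cov\<close> enters here. Each \<open>k y\<close> commutes with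
  the action, so covariance of the glued family amounts to \<open>k\<close> being constant on
  orbits; otherwise \<open>k\<close> may depend on \<open>y\<close> arbitrarily.\<close>

lemma glue_Efib:
  assumes k: "\<And>y. k y \<in> Efib" and inv: "\<And>y t. t \<in> carrier T \<Longrightarrow> k (\<delta> t y) = k y"
  shows "(\<lambda>x. k (p x) x) \<in> Efib"
proof -
  define F where "F y = restrict (k y) (p -` {y})" for y
  have "F (\<delta> t y) = restrict (\<sigma> t \<circ> F y \<circ> \<sigma> (inv\<^bsub>T\<^esub> t)) (p -` {\<delta> t y})" if t: "t \<in> carrier T" for t y
    unfolding F_def inv[OF t]
  proof (rule restrict_ext)
    fix x
    assume "x \<in> p -` {\<delta> t y}"
    then have "p (\<sigma> (inv\<^bsub>T\<^esub> t) x) = \<delta> (inv\<^bsub>T\<^esub> t) (\<delta> t y)"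
      using t by (simp add: p_act)
    also have "\<dots> = y"
      using Y.act_inv(1)[OF t] by (simp add: fun_eq_iff)
    finally have "p (\<sigma> (inv\<^bsub>T\<^esub> t) x) = y" .
    moreover have "\<sigma> t (k y (\<sigma> (inv\<^bsub>T\<^esub> t) x)) = k y (\<sigma> t (\<sigma> (inv\<^bsub>T\<^esub> t) x))"
      using X.E_commute[OF _ t] k by (simp add: Efib_iff)
    moreover have "\<sigma> t (\<sigma> (inv\<^bsub>T\<^esub> t) x) = x"
      using X.act_inv(2)[OF t] by (simp add: fun_eq_iff)
    ultimately show "k y x = (\<sigma> t \<circ> restrict (k y) (p -` {y}) \<circ> \<sigma> (inv\<^bsub>T\<^esub> t)) x"
      by simp
  qed
  moreover have "F y \<in> (\<lambda>f. restrict f (p -` {y})) ` Efib" for y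
    using k by (auto simp: F_def)
  ultimately have "F \<in> Cov T \<sigma> \<delta> p y0"
    by (simp add: Cov_def)
  then obtain f where f: "f \<in> Efib" "F = fibre_restrictions p f"
    using cov by blast
  have "f x = k (p x) x" for x
    using fun_cong[OF fun_cong[OF f(2)], of "p x" x] by (simp add: F_def fibre_restrictions_def)
  then have "f = (\<lambda>x. k (p x) x)"
    by (rule ext)
  then show ?thesis
    using f(1) by simp
qed

text \<open>Dividing the family by one member \<open>g\<close> makes it fibre-preserving, so
  \<open>glue_Efib\<close> applies; composing the glued map with \<open>g\<close> restores the
  translation by \<open>z\<close>.\<close>

lemma glue_G:
  assumes k: "\<And>y. k y \<in> G" and \<pi>k: "\<And>y. \<pi> (k y) = z"
    and inv: "\<And>y t. t \<in> carrier T \<Longrightarrow> k (\<delta> t y) = k y"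
  shows "(\<lambda>x. k (p x) x) \<in> G" "\<pi> (\<lambda>x. k (p x) x) = z"
proof -
  define g where "g = k y0"
  have g: "g \<in> G" "\<pi> g = z"
    using k \<pi>k by (auto simp: g_def)
  define h where "h y = inv\<^bsub>\<G>\<^esub> g \<circ> k y" for y
  have hG: "h y \<in> G" for y
    unfolding h_def by (intro G_comp G_inv g k)
  have "\<pi> (h y) = \<one>\<^bsub>Q\<^esub>" for y
    using g k \<pi>k by (simp add: h_def induced_comp G_E G_inv induced_inv)
  then have "h y \<in> Efib" for y
    using hG G_E by (simp add: Efib_iff Q_one)
  then have hE: "(\<lambda>x. h (p x) x) \<in> Efib"
    by (rule glue_Efib) (simp add: h_def inv)
  have eq: "(\<lambda>x. k (p x) x) = g \<circ> (\<lambda>x. h (p x) x)"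
    using g k by (simp add: fun_eq_iff h_def G_inv G_e)
  show "(\<lambda>x. k (p x) x) \<in> G"
    unfolding mem_G
  proof (intro conjI)
    show "(\<lambda>x. k (p x) x) \<in> E"
      unfolding eq using hE g by (intro X.E_comp) (auto simp: G_E Efib_iff)
  qed (use k in \<open>simp_all add: fun_eq_iff G_e\<close>)
  show "\<pi> (\<lambda>x. k (p x) x) = z"
    using \<pi>k by (simp add: induced_def base_point)
qed

section \<open>Orbit representatives, the product decomposition and the section\<close>

definition orbit_rep :: "'y set \<Rightarrow> 'y" where
  "orbit_rep \<O> = (SOME z. z \<in> \<O>)"

lemma act_compose: "\<lbrakk>s \<in> carrier T; t \<in> carrier T\<rbrakk> \<Longrightarrow> \<delta> s (\<delta> t y) = \<delta> (s \<otimes>\<^bsub>T\<^esub> t) y"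
  using Y.act_mult by simp

lemma orbit_act:
  assumes t: "t \<in> carrier T"
  shows "orbit T \<delta> (\<delta> t y) = orbit T \<delta> y"
proof -
  have "\<exists>s'\<in>carrier T. \<delta> s y = \<delta> s' (\<delta> t y)" if s: "s \<in> carrier T" for s
  proof
    show "\<delta> s y = \<delta> (s \<otimes>\<^bsub>T\<^esub> inv\<^bsub>T\<^esub> t) (\<delta> t y)"
      using s t by (simp add: act_compose X.T.m_assoc)
  qed (use s t in simp)
  note 1 = this
  show ?thesis
  proof (intro equalityI subsetI)
    fix z
    assume "z \<in> orbit T \<delta> (\<delta> t y)"
    then obtain s where "s \<in> carrier T" "z = \<delta> s (\<delta> t y)"
      by (auto simp: orbit_def)
    then show "z \<in> orbit T \<delta> y"
      using t act_compose[of s t y] by (auto simp: orbit_def)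
  next
    fix z
    assume "z \<in> orbit T \<delta> y"
    then obtain s where "s \<in> carrier T" "z = \<delta> s y"
      by (auto simp: orbit_def)
    with 1[of s] show "z \<in> orbit T \<delta> (\<delta> t y)"
      by (auto simp: orbit_def)
  qed
qed

lemma orbit_repE:
  obtains t where "t \<in> carrier T" "\<delta> t (orbit_rep (orbit T \<delta> y)) = y"
    "orbit T \<delta> (orbit_rep (orbit T \<delta> y)) = orbit T \<delta> y"
proof -
  have "\<delta> \<one>\<^bsub>T\<^esub> y \<in> orbit T \<delta> y"
    by (auto simp: orbit_def)
  then have "orbit_rep (orbit T \<delta> y) \<in> orbit T \<delta> y"
    unfolding orbit_rep_def by (rule someI)
  then obtain s where s: "s \<in> carrier T" "orbit_rep (orbit T \<delta> y) = \<delta> s y"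
    by (auto simp: orbit_def)
  have "\<delta> (inv\<^bsub>T\<^esub> s) (\<delta> s y) = y"
    using Y.act_inv(1)[OF s(1)] by (simp add: fun_eq_iff)
  then show thesis
    using that[of "inv\<^bsub>T\<^esub> s"] s orbit_act by simp
qed

lemma orbit_rep_orbit:
  assumes "\<O> \<in> orbits T UNIV \<delta>"
  shows "orbit T \<delta> (orbit_rep \<O>) = \<O>"
proof -
  obtain z where "\<O> = orbit T \<delta> z"
    using assms by (auto simp: orbits_def)
  then show ?thesis
    using orbit_repE[of z] by metis
qed

text \<open>
  An element of the structure group over \<open>y\<close> is read off on the fibre over each orbit
  representative and transported to the fibre over \<open>y\<close> by an element of \<open>\<G>\<close>.
  Since \<open>\<G>fib\<close> commutes with the action, this determines it, and
  gluing shows that the components can be prescribed independently.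
\<close>

lemma \<G>fib_iso_product:
  "\<G>fib \<cong> product_group (orbits T UNIV \<delta>) (\<lambda>_. fibre_group T \<sigma> p y0 e y)"
proof -
  define B where "B = e ` (p -` {y})"
  have mem_B: "w \<in> B \<longleftrightarrow> e w = w \<and> p w = y" for w
    unfolding B_def by (metis (mono_tags) image_iff e_e p_e vimage_singleton_eq)
  \<comment> \<open>\<open>a \<O>\<close> lies over \<open>orbit_rep \<O> - y\<close>, so it carries
    the fibre over \<open>y\<close> to the fibre over the representative; its inverse in
    \<open>\<G>\<close> leads back, up to an application of \<open>e\<close>.\<close>
  define a where "a \<O> = (SOME f. f \<in> G \<and> \<pi> f = inv\<^bsub>Q\<^esub> y \<otimes>\<^bsub>Q\<^esub> orbit_rep \<O>)" for \<O>
  have a: "a \<O> \<in> G" "\<pi> (a \<O>) = inv\<^bsub>Q\<^esub> y \<otimes>\<^bsub>Q\<^esub> orbit_rep \<O>" for \<O>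
  proof -
    from someI_ex[OF induced_surj_G] show "a \<O> \<in> G" "\<pi> (a \<O>) = inv\<^bsub>Q\<^esub> y \<otimes>\<^bsub>Q\<^esub> orbit_rep \<O>"
      by (simp_all add: a_def)
  qed
  let ?a' = "\<lambda>\<O>. inv\<^bsub>\<G>\<^esub> a \<O>"
  note a' = G_inv[OF a(1)]
  have mem_Gfib': "f \<in> Gfib \<longleftrightarrow> f \<in> G \<and> \<pi> f = \<one>\<^bsub>Q\<^esub>" for f
    by (simp add: mem_Gfib Q_one)
  have p_a: "p (a \<O> w) = orbit_rep \<O>" if "p w = y" for \<O> w
    using that by (simp add: p_E[OF G_E[OF a(1)]] a(2) flip: Q.m_assoc)
  have p_a': "p (?a' \<O> x) = y" if "p x = orbit_rep \<O>" for \<O> x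
    using that by (simp add: p_E[OF G_E[OF a'(1)]] induced_inv a Q.inv_mult_group flip: Q.m_assoc)
  have conj1: "?a' \<O> \<circ> f \<circ> a \<O> \<in> Gfib" and conj2: "a \<O> \<circ> f \<circ> ?a' \<O> \<in> Gfib" if "f \<in> Gfib" for f \<O>
    using that a(1)[of \<O>] a'(1)[of \<O>] G_comp
    by (simp_all add: mem_Gfib' induced_comp G_E X.E_comp induced_inv)
  have GfibG: "f \<in> G" and Gfib_p: "p (f x) = p x" if "f \<in> Gfib" for f x
    using that p_Efib by (auto simp: mem_Gfib Efib_iff G_E)
  have B_inv: "f w \<in> B" if "f \<in> Gfib" "w \<in> B" for f w
    using that by (simp add: mem_B G_e GfibG Gfib_p)
  let ?\<Psi> = "\<lambda>f. \<lambda>\<O>\<in>orbits T UNIV \<delta>. restrict (?a' \<O> \<circ> f \<circ> a \<O>) B"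
  have "?\<Psi> \<in> Group.iso \<G>fib (product_group (orbits T UNIV \<delta>) (\<lambda>_. fibre_group T \<sigma> p y0 e y))"
    unfolding iso_iff
  proof (intro conjI)
    show "?\<Psi> \<in> hom \<G>fib (product_group (orbits T UNIV \<delta>) (\<lambda>_. fibre_group T \<sigma> p y0 e y))"
    proof (rule homI)
      show "?\<Psi> f \<in> carrier (product_group (orbits T UNIV \<delta>) (\<lambda>_. fibre_group T \<sigma> p y0 e y))"
        if "f \<in> Gfib" for f
        using conj1[OF that] by (auto simp: fibre_group_def B_def)
      fix f g
      assume fg: "f \<in> Gfib" "g \<in> Gfib"
      have "restrict (?a' \<O> \<circ> (f \<circ> g) \<circ> a \<O>) B =
          compose B (restrict (?a' \<O> \<circ> f \<circ> a \<O>) B) (restrict (?a' \<O> \<circ> g \<circ> a \<O>) B)" for \<O>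
        unfolding compose_def
      proof (rule restrict_ext)
        fix w
        assume w: "w \<in> B"
        show "(?a' \<O> \<circ> (f \<circ> g) \<circ> a \<O>) w =
            restrict (?a' \<O> \<circ> f \<circ> a \<O>) B (restrict (?a' \<O> \<circ> g \<circ> a \<O>) B w)"
          using B_inv[OF conj1[OF fg(2), of \<O>] w] w fg by (simp add: a' G_e GfibG)
      qed
      then show "?\<Psi> (f \<otimes>\<^bsub>\<G>fib\<^esub> g) =
          ?\<Psi> f \<otimes>\<^bsub>product_group (orbits T UNIV \<delta>) (\<lambda>_. fibre_group T \<sigma> p y0 e y)\<^esub> ?\<Psi> g"
        by (auto simp: mult_\<G>fib fibre_group_def B_def intro!: restrict_ext)
    qed
    show "inj_on ?\<Psi> Gfib"
    proof (intro inj_onI ext)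
      fix f g x
      assume f: "f \<in> Gfib" and g: "g \<in> Gfib" and eq: "?\<Psi> f = ?\<Psi> g"
      let ?O = "orbit T \<delta> (p x)"
      obtain t where t: "t \<in> carrier T" "\<delta> t (orbit_rep ?O) = p x"
        by (rule orbit_repE)
      \<comment> \<open>Both maps commute with \<open>\<sigma> t\<close>, so it suffices to compare
        them at \<open>x'\<close>, which lies over the representative. The point \<open>w\<close>
        chosen below is the one in \<open>B\<close> that \<open>a\<close> sends to
        \<open>e x'\<close>.\<close>
      define x' where "x' = \<sigma> (inv\<^bsub>T\<^esub> t) x"
      have x: "x = \<sigma> t x'"
        using X.act_inv(2)[OF t(1)] by (simp add: x'_def fun_eq_iff)
      have "p x' = \<delta> (inv\<^bsub>T\<^esub> t) (\<delta> t (orbit_rep ?O))"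
        using t by (simp add: x'_def p_act)
      also have "\<dots> = orbit_rep ?O"
        using Y.act_inv(1)[OF t(1)] by (simp add: fun_eq_iff)
      finally have px': "p x' = orbit_rep ?O" .
      define w where "w = ?a' ?O x'"
      have wB: "w \<in> B"
        using px' by (simp add: mem_B w_def G_e a' p_a')
      have "?O \<in> orbits T UNIV \<delta>"
        by (auto simp: orbits_def)
      then have "?a' ?O (f (a ?O w)) = ?a' ?O (g (a ?O w))"
        using fun_cong[OF fun_cong[OF eq, of ?O], of w] wB by simp
      then have "?a' ?O (f x') = ?a' ?O (g x')"
        using f g by (simp add: w_def a' G_e GfibG)
      then have "a ?O (?a' ?O (f x')) = a ?O (?a' ?O (g x'))"
        by simp
      then have "f x' = g x'"
        using f g by (simp add: a' G_e GfibG)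
      then show "f x = g x"
        using X.E_commute[OF G_E[OF GfibG[OF f]] t(1), of x'] X.E_commute[OF G_E[OF GfibG[OF g]] t(1), of x']
        by (simp add: x)
    qed
    show "?\<Psi> ` Gfib = carrier (product_group (orbits T UNIV \<delta>) (\<lambda>_. fibre_group T \<sigma> p y0 e y))"
    proof (intro equalityI subsetI)
      fix F
      assume "F \<in> ?\<Psi> ` Gfib"
      then show "F \<in> carrier (product_group (orbits T UNIV \<delta>) (\<lambda>_. fibre_group T \<sigma> p y0 e y))"
        using conj1 by (fastforce simp: fibre_group_def B_def)
    next
      fix F
      assume F: "F \<in> carrier (product_group (orbits T UNIV \<delta>) (\<lambda>_. fibre_group T \<sigma> p y0 e y))"
      then have "\<exists>k. \<forall>\<O>\<in>orbits T UNIV \<delta>. k \<O> \<in> Gfib \<and> F \<O> = restrict (k \<O>) B"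
        by (intro bchoice) (fastforce simp: fibre_group_def B_def PiE_iff)
      then obtain k where k: "k \<O> \<in> Gfib" "F \<O> = restrict (k \<O>) B" if "\<O> \<in> orbits T UNIV \<delta>" for \<O>
        by blast
      \<comment> \<open>Conjugation by \<open>a\<close> undoes the one in the definition of the
        isomorphism. As \<open>h z\<close> depends only on the orbit of \<open>z\<close>, the
        components can be glued.\<close>
      define h where "h z = a (orbit T \<delta> z) \<circ> k (orbit T \<delta> z) \<circ> ?a' (orbit T \<delta> z)" for z
      have h: "h z \<in> Gfib" for z
        unfolding h_def by (intro conj2 k) (auto simp: orbits_def)
      have h_act: "h (\<delta> t z) = h z" if "t \<in> carrier T" for t z
        by (simp add: h_def orbit_act that)
      define f where "f = (\<lambda>x. h (p x) x)"
      have f: "f \<in> Gfib"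
        unfolding mem_Gfib f_def using h glue_G[of h y0, OF _ _ h_act] by (simp add: mem_Gfib)
      have "?\<Psi> f = F"
      proof (rule ext)
        fix \<O>
        show "?\<Psi> f \<O> = F \<O>"
        proof (cases "\<O> \<in> orbits T UNIV \<delta>")
          case True
          \<comment> \<open>The point \<open>a \<O> w\<close> lies over the representative of
            \<open>\<O>\<close>; there \<open>f\<close> is the component built from
            \<open>k \<O>\<close>, and the two conjugations cancel.\<close>
          have "(?a' \<O> \<circ> f \<circ> a \<O>) w = k \<O> w" if "w \<in> B" for w
            using that GfibG[OF k(1)[OF True]]
            by (simp add: f_def h_def mem_B p_a orbit_rep_orbit[OF True] a' G_e)
          then show ?thesis
            using True k(2)[OF True] by (auto intro: restrict_ext)
        next
          case False
          then show ?thesis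
            using F by (auto simp: PiE_iff extensional_def)
        qed
      qed
      then show "F \<in> ?\<Psi> ` Gfib"
        using f by blast
    qed
  qed
  then show ?thesis
    by (rule is_isoI)
qed

text \<open>
  Choose \<open>c y \<in> \<G>\<close> over \<open>y\<close> with \<open>c (\<delta> t y) = \<sigma> t \<circ> c y\<close>. The fibrewise definition
  \<open>c (y + z) \<circ> (c y)\<inverse>\<close> is multiplicative in \<open>z\<close> and depends only on the orbit of \<open>y\<close>,
  so gluing turns it into a section of \<open>\<pi>\<close>.
\<close>

lemma section_exists:
  assumes eff: "\<forall>t\<in>carrier T. \<delta> t = id \<longrightarrow> \<sigma> t = id"
  obtains s where "s \<in> hom Q \<G>" "\<And>z. \<pi> (s z) = z"
proof -
  define l where "l z = (SOME f. f \<in> G \<and> \<pi> f = z)" for z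
  have l: "l z \<in> G" "\<pi> (l z) = z" for z
  proof -
    from someI_ex[OF induced_surj_G] show "l z \<in> G" "\<pi> (l z) = z"
      by (simp_all add: l_def)
  qed
  let ?r = "\<lambda>y. orbit_rep (orbit T \<delta> y)"
  define \<tau> where "\<tau> y = (SOME t. t \<in> carrier T \<and> \<delta> t (?r y) = y)" for y
  have \<tau>: "\<tau> y \<in> carrier T" "\<delta> (\<tau> y) (?r y) = y" for y
  proof -
    have "\<exists>t. t \<in> carrier T \<and> \<delta> t (?r y) = y"
      by (metis orbit_repE)
    from someI_ex[OF this] show "\<tau> y \<in> carrier T" "\<delta> (\<tau> y) (?r y) = y"
      by (simp_all add: \<tau>_def)
  qed
  \<comment> \<open>A translation of Y is determined by one value, so \<open>s - t\<close> acts
    trivially on Y, and \<open>eff\<close> transfers this to X. It makes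
    \<open>\<sigma> (\<tau> y)\<close> independent of the choice of the time
    \<open>\<tau> y\<close>.\<close>
  have act_eq: "\<sigma> s = \<sigma> t" if st: "s \<in> carrier T" "t \<in> carrier T" and eq: "\<delta> s z = \<delta> t z" for s t z
  proof -
    let ?u = "s \<otimes>\<^bsub>T\<^esub> inv\<^bsub>T\<^esub> t"
    have "\<delta> s y0 = \<delta> t y0"
      using eq Y.act_factor_group[OF st(1), of z] Y.act_factor_group[OF st(2), of z] by simp
    then have "\<delta> s y = \<delta> t y" for y
      using Y.act_factor_group[OF st(1), of y] Y.act_factor_group[OF st(2), of y] by simp
    then have "\<delta> s = \<delta> t"
      by blast
    then have "\<delta> ?u = id"
      using st Y.act_mult[of s "inv\<^bsub>T\<^esub> t"] Y.act_inv(2)[OF st(2)] by simp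
    then have "\<sigma> ?u = id"
      using eff st by simp
    then have "\<sigma> (?u \<otimes>\<^bsub>T\<^esub> t) = \<sigma> t"
      using X.act_mult[of ?u t] st by simp
    then show ?thesis
      using st by (simp add: X.T.m_assoc)
  qed
  define c where "c y = \<sigma> (\<tau> y) \<circ> l (?r y)" for y
  have act_G: "\<sigma> t \<circ> f \<in> G" if "t \<in> carrier T" "f \<in> G" for t f
    using that X.E_commute[OF S.e_closed that(1)]
    by (auto simp: mem_G X.E_comp X.act_in_E fun_eq_iff)
  have cG: "c y \<in> G" for y
    unfolding c_def by (intro act_G \<tau> l)
  have \<pi>c: "\<pi> (c y) = y" for y
  proof -
    have "\<pi> (c y) = \<delta> (\<tau> y) y0 \<otimes>\<^bsub>Q\<^esub> ?r y"
      using \<tau>(1) l by (simp add: c_def induced_comp X.act_in_E G_E induced_act)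
    also have "\<dots> = \<delta> (\<tau> y) (?r y)"
      using Y.act_factor_group[OF \<tau>(1), of y "?r y"] Q.m_comm[of "?r y" "\<delta> (\<tau> y) y0"] by simp
    finally show ?thesis
      by (simp add: \<tau>(2))
  qed
  \<comment> \<open>Both \<open>\<tau> (\<delta> t y)\<close> and \<open>t\<close> added to
    \<open>\<tau> y\<close> lead from the representative to \<open>\<delta> t y\<close>, so they act
    alike on X.\<close>
  have c_act: "c (\<delta> t y) = \<sigma> t \<circ> c y" if t: "t \<in> carrier T" for t y
  proof -
    have "\<delta> (\<tau> (\<delta> t y)) (?r y) = \<delta> (t \<otimes>\<^bsub>T\<^esub> \<tau> y) (?r y)"
      using \<tau>(2)[of "\<delta> t y"] t \<tau>(1)[of y] \<tau>(2)[of y] by (simp add: orbit_act flip: act_compose)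
    then have "\<sigma> (\<tau> (\<delta> t y)) = \<sigma> t \<circ> \<sigma> (\<tau> y)"
      using act_eq[of "\<tau> (\<delta> t y)" "t \<otimes>\<^bsub>T\<^esub> \<tau> y"] \<tau>(1) t by (simp add: X.act_mult)
    then show ?thesis
      by (simp add: c_def orbit_act[OF t] o_assoc)
  qed
  \<comment> \<open>The inverse of \<open>c y\<close> takes the fibre over \<open>y\<close> to the
    one over \<open>y0\<close>, and \<open>c\<close> at \<open>y + z\<close> takes this on to the
    fibre over \<open>y + z\<close>.\<close>
  define k where "k z y = c (y \<otimes>\<^bsub>Q\<^esub> z) \<circ> inv\<^bsub>\<G>\<^esub> c y" for z y
  have kG: "k z y \<in> G" for z y
    unfolding k_def by (intro G_comp G_inv cG)
  have \<pi>k: "\<pi> (k z y) = z" for z y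
    using Q.m_comm[of y z] by (simp add: k_def induced_comp G_E cG G_inv induced_inv \<pi>c Q.m_assoc)
  \<comment> \<open>The factors \<open>\<sigma> t\<close> coming from \<open>c_act\<close> cancel.
    As \<open>\<sigma> t\<close> need not lie in \<open>\<G>\<close>, the inverse of
    \<open>\<sigma> t \<circ> c y\<close> is computed pointwise.\<close>
  have k_act: "k z (\<delta> t y) = k z y" if t: "t \<in> carrier T" for t z y
  proof
    fix x
    let ?i = "inv\<^bsub>\<G>\<^esub> c (\<delta> t y)"
    have i: "?i (\<sigma> t (c y x')) = e x'" for x'
      using G_inv(3)[OF cG[of "\<delta> t y"], of x'] by (simp add: c_act[OF t])
    have "?i (\<sigma> t x) = ?i (e (\<sigma> t x))"
      using G_e(2)[OF G_inv(1)[OF cG[of "\<delta> t y"]]] by simp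
    also have "e (\<sigma> t x) = \<sigma> t (c y ((inv\<^bsub>\<G>\<^esub> c y) x))"
      using X.E_commute[OF S.e_closed t] by (simp add: G_inv(2)[OF cG])
    finally have "?i (\<sigma> t x) = (inv\<^bsub>\<G>\<^esub> c y) x"
      by (simp add: i G_e(1)[OF G_inv(1)[OF cG]])
    then have "\<sigma> t (?i x) = (inv\<^bsub>\<G>\<^esub> c y) x"
      using X.E_commute[OF G_E[OF G_inv(1)[OF cG]] t] by simp
    then have "c (y \<otimes>\<^bsub>Q\<^esub> z) (\<sigma> t (?i x)) = k z y x"
      by (simp add: k_def)
    then show "k z (\<delta> t y) x = k z y x"
      using X.E_commute[OF G_E[OF cG] t]
      by (simp add: k_def c_act[OF t] flip: act_mult_Q[OF t])
  qed
  define s where "s z = (\<lambda>x. k z (p x) x)" for z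
  have s: "s z \<in> G" "\<pi> (s z) = z" for z
    unfolding s_def using glue_G[of "k z" z, OF kG \<pi>k k_act] by auto
  have "s \<in> hom Q \<G>"
  proof (rule homI)
    show "s (w \<otimes>\<^bsub>Q\<^esub> z) = s w \<otimes>\<^bsub>\<G>\<^esub> s z" for w z
    proof
      fix x
      have pz: "p (k z (p x) x) = p x \<otimes>\<^bsub>Q\<^esub> z"
        using p_E[OF G_E[OF kG]] by (simp add: \<pi>k)
      \<comment> \<open>A telescoping product: \<open>s z\<close> moves \<open>x\<close> over
        \<open>p x + z\<close>, so \<open>s w\<close> begins there with the inverse of the very
        factor \<open>c\<close> with which \<open>s z\<close> ends.\<close>
      have "(s w \<circ> s z) x = c (p x \<otimes>\<^bsub>Q\<^esub> z \<otimes>\<^bsub>Q\<^esub> w) ((inv\<^bsub>\<G>\<^esub> c (p x)) x)"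
        using pz by (simp add: s_def k_def G_inv cG G_e)
      also have "\<dots> = s (w \<otimes>\<^bsub>Q\<^esub> z) x"
        using Q.m_comm[of z w] by (simp add: s_def k_def Q.m_assoc)
      finally show "s (w \<otimes>\<^bsub>Q\<^esub> z) x = (s w \<otimes>\<^bsub>\<G>\<^esub> s z) x"
        by (simp add: mult_\<G>)
    qed
  qed (use s in simp)
  then show thesis
    using s that by blast
qed

end

text \<open>The two requirements on \<open>\<Phi>\<close> say that the semidirect product is
  compatible with the inclusion of \<open>\<G>fib\<close> and the projection to Y, not merely
  abstractly isomorphic to \<open>\<G>\<close>. The first also identifies an entry
  \<open>(a, 1)\<close> of the matrix with \<open>a\<close>.\<close>

theorem corollary3p14:
  fixes T :: "('t, 'b) monoid_scheme"
    and \<sigma> :: "'t \<Rightarrow> 'x \<Rightarrow> 'x::metric_space"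
    and \<delta> :: "'t \<Rightarrow> 'y \<Rightarrow> 'y::metric_space"
    and p :: "'x \<Rightarrow> 'y"
    and y0 :: 'y
    and e :: "'x \<Rightarrow> 'x"
  defines "E \<equiv> ellis T \<sigma>"
    and "Efib \<equiv> ellis_fib T \<sigma> p y0"
    and "Y \<equiv> factor_group T \<delta> y0"
    and "\<G> \<equiv> local_group (ellis T \<sigma>) e"
    and "\<G>fib \<equiv> local_group (ellis_fib T \<sigma> p y0) e"
    and "M \<equiv> (ellis T \<sigma>)\<lparr>carrier := semigroup_kernel (ellis T \<sigma>)\<rparr>"
    and "Mfib \<equiv> (ellis_fib T \<sigma> p y0)\<lparr>carrier := semigroup_kernel (ellis_fib T \<sigma> p y0)\<rparr>"
  assumes "minimal_system T \<sigma>"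
    and "equicontinuous_system T \<delta>"
    and "factor_map T \<sigma> \<delta> p"
    and "fibre_restrictions p ` carrier Efib = Cov T \<sigma> \<delta> p y0"
    and "minimal_idempotent E e"
  shows "local_group Mfib e = \<G>fib \<and> local_group M e = \<G> \<and> group \<G>fib \<and> group \<G>
    \<and> (\<forall>y. \<G>fib \<cong> product_group (orbits T UNIV \<delta>) (\<lambda>_. fibre_group T \<sigma> p y0 e y))
    \<and> induced p y0 \<in> epi \<G> Y \<and> kernel \<G> Y (induced p y0) = carrier \<G>fib
    \<and> rees_semigroup \<G> (min_right_ideals Mfib) (min_left_ideals Mfib) (rees_matrix Mfib e) \<cong> M
    \<and> ((\<forall>t\<in>carrier T. \<delta> t = id \<longrightarrow> \<sigma> t = id) \<longrightarrow>
        (\<exists>\<phi>. \<phi> \<in> hom Y (AutoGroup \<G>fib)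
           \<and> (\<exists>\<Phi> \<in> Group.iso (semidirect_product \<G>fib Y \<phi>) \<G>.
                (\<forall>g\<in>carrier \<G>fib. \<Phi> (g, \<one>\<^bsub>Y\<^esub>) = g)
                \<and> (\<forall>g\<in>carrier \<G>fib. \<forall>y\<in>carrier Y. induced p y0 (\<Phi> (g, y)) = y))
           \<and> rees_semigroup (semidirect_product \<G>fib Y \<phi>)
               (min_right_ideals Mfib) (min_left_ideals Mfib)
               (\<lambda>L R. (rees_matrix Mfib e L R, \<one>\<^bsub>Y\<^esub>)) \<cong> M))"
proof -
  \<comment> \<open>Minimality descends to Y: the continuous surjection \<open>p\<close> maps a
    dense orbit onto a dense orbit.\<close>
  have min_Y: "minimal_system T \<delta>"
    unfolding minimal_system_def
  proof (intro conjI allI)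
    show "dynamical_system T \<delta>"
      using assms(9) by (simp add: equicontinuous_system_def)
    fix y
    have p: "continuous_on UNIV p" "surj p" "\<And>t x. t \<in> carrier T \<Longrightarrow> p (\<sigma> t x) = \<delta> t (p x)"
      using assms(10) by (auto simp: factor_map_def)
    obtain x where x: "y = p x"
      using p(2) by blast
    have "p ` closure (orbit T \<sigma> x) \<subseteq> closure (orbit T \<delta> y)"
    proof (rule image_closure_subset)
      show "p ` orbit T \<sigma> x \<subseteq> closure (orbit T \<delta> y)"
        using p(3) x closure_subset by (fastforce simp: orbit_def)
    qed (use p(1) continuous_on_subset in auto)
    then show "closure (orbit T \<delta> y) = UNIV"
      using assms(8) p(2) by (auto simp: minimal_system_def)
  qed
  have "cov_extension T \<sigma> \<delta> y0 p e"
    using assms(8-12) min_Y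
    by unfold_locales (simp_all add: minimal_system_def E_def Efib_def)
  then interpret cov_extension T \<sigma> \<delta> y0 p e .
  note defs = E_def Efib_def Y_def \<G>_def \<G>fib_def M_def Mfib_def
  have fib: "ellis_fib T \<sigma> p y0 = ellis T \<sigma>\<lparr>carrier := carrier (ellis_fib T \<sigma> p y0)\<rparr>"
    by (simp add: ellis_fib_def)
  have Mfib_eq: "Mfib = ellis T \<sigma>\<lparr>carrier := semigroup_kernel (ellis_fib T \<sigma> p y0)\<rparr>"
    by (simp add: Mfib_def ellis_fib_def)
  have rees1: "rees_semigroup \<G> (min_right_ideals Mfib) (min_left_ideals Mfib) (rees_matrix Mfib e) \<cong> M"
    and rees2: "\<And>L R. \<lbrakk>R \<in> min_right_ideals Mfib; L \<in> min_left_ideals Mfib\<rbrakk>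
      \<Longrightarrow> rees_matrix Mfib e L R \<in> carrier \<G>fib"
    using rees_iso_kernel_subsemigroup[where S = "ellis T \<sigma>" and e = e and N = "carrier (ellis_fib T \<sigma> p y0)",
        folded fib Mfib_eq, OF S.group_idempotent_axioms F.group_idempotent_axioms]
      idempotent_in_Efib Efib_iff by (auto simp: defs)
  show ?thesis
  proof (intro conjI impI allI)
    show "local_group Mfib e = \<G>fib" "local_group M e = \<G>"
      using F.local_group_kernel S.local_group_kernel by (simp_all add: defs)
    show "group \<G>fib" "group \<G>"
      using F.local_group S.local_group by (simp_all add: defs)
    show "\<G>fib \<cong> product_group (orbits T UNIV \<delta>) (\<lambda>_. fibre_group T \<sigma> p y0 e y)" for y
      unfolding \<G>fib_def by (rule \<G>fib_iso_product)
    show "induced p y0 \<in> epi \<G> Y"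
      using induced_hom induced_surj_G Y.carrier_factor_group unfolding epi_def defs
      by (auto simp: image_iff) metis
    show "kernel \<G> Y (induced p y0) = carrier \<G>fib"
      unfolding defs by (rule kernel_induced)
    show "rees_semigroup \<G> (min_right_ideals Mfib) (min_left_ideals Mfib) (rees_matrix Mfib e) \<cong> M"
      by (rule rees1)
    assume "\<forall>t\<in>carrier T. \<delta> t = id \<longrightarrow> \<sigma> t = id"
    then obtain s where s: "s \<in> hom Y \<G>" "\<And>z. induced p y0 (s z) = z"
      using section_exists unfolding defs by metis
    have grp: "group \<G>" "group Y"
      using S.local_group Y.comm_group_factor_group by (simp_all add: defs comm_group_def)
    obtain \<phi> where \<phi>: "\<phi> \<in> hom Y (AutoGroup \<G>fib)"
      "(\<lambda>(n, q). n \<otimes>\<^bsub>\<G>\<^esub> s q) \<in> Group.iso (semidirect_product \<G>fib Y \<phi>) \<G>"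
      using split_extension_semidirect[of \<G> Y "induced p y0" s] grp s induced_hom \<G>fib_eq
      unfolding defs by metis
    interpret structure_group: group \<G>
      by (rule grp(1))
    interpret s: group_hom Y \<G> s
      by (intro group_hom.intro group_hom_axioms.intro grp s(1))
    have fibG: "g \<in> carrier \<G>" "induced p y0 g = \<one>\<^bsub>Y\<^esub>" if "g \<in> carrier \<G>fib" for g
      using that mem_Gfib Q_one by (auto simp: defs)
    have induced_hom': "induced p y0 \<in> hom \<G> Y"
      unfolding \<G>_def Y_def by (rule induced_hom)
    have \<Phi>1: "g \<otimes>\<^bsub>\<G>\<^esub> s \<one>\<^bsub>Y\<^esub> = g" if "g \<in> carrier \<G>fib" for g
      using fibG that by simp
    have \<Phi>2: "induced p y0 (g \<otimes>\<^bsub>\<G>\<^esub> s y) = y" if "g \<in> carrier \<G>fib" "y \<in> carrier Y" for g y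
      using that fibG s(2) by (simp add: hom_mult[OF induced_hom'])
    \<comment> \<open>The isomorphism sends an entry \<open>(a, 1)\<close> to the product of
      \<open>a\<close> and \<open>s 1\<close>, which is \<open>a\<close>, so the two sandwich
      matrices correspond.\<close>
    have "rees_semigroup (semidirect_product \<G>fib Y \<phi>) (min_right_ideals Mfib) (min_left_ideals Mfib)
        (\<lambda>L R. (rees_matrix Mfib e L R, \<one>\<^bsub>Y\<^esub>))
      \<cong> rees_semigroup \<G> (min_right_ideals Mfib) (min_left_ideals Mfib) (rees_matrix Mfib e)"
    proof (rule rees_semigroup_iso[OF bij_betw_id bij_betw_id \<phi>(2)])
      fix x z
      assume "x \<in> carrier (semidirect_product \<G>fib Y \<phi>)" "z \<in> carrier (semidirect_product \<G>fib Y \<phi>)"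
      moreover have "\<phi> q g \<in> carrier \<G>fib" if "q \<in> carrier Y" "g \<in> carrier \<G>fib" for q g
        using hom_in_carrier[OF \<phi>(1) that(1)] that(2)
        by (auto simp: AutoGroup_def auto_def hom_def)
      moreover have "monoid \<G>fib" "monoid Y"
        using F.local_group grp by (simp_all add: defs group.is_monoid)
      ultimately show "x \<otimes>\<^bsub>semidirect_product \<G>fib Y \<phi>\<^esub> z \<in> carrier (semidirect_product \<G>fib Y \<phi>)"
        by (auto simp: semidirect_product_def monoid.m_closed)
    qed (use rees2 \<Phi>1 in \<open>auto simp: semidirect_product_def\<close>)
    also note rees1
    finally have rees3: "rees_semigroup (semidirect_product \<G>fib Y \<phi>)
        (min_right_ideals Mfib) (min_left_ideals Mfib) (\<lambda>L R. (rees_matrix Mfib e L R, \<one>\<^bsub>Y\<^esub>)) \<cong> M" .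
    show "\<exists>\<phi>. \<phi> \<in> hom Y (AutoGroup \<G>fib)
           \<and> (\<exists>\<Phi> \<in> Group.iso (semidirect_product \<G>fib Y \<phi>) \<G>.
                (\<forall>g\<in>carrier \<G>fib. \<Phi> (g, \<one>\<^bsub>Y\<^esub>) = g)
                \<and> (\<forall>g\<in>carrier \<G>fib. \<forall>y\<in>carrier Y. induced p y0 (\<Phi> (g, y)) = y))
           \<and> rees_semigroup (semidirect_product \<G>fib Y \<phi>)
               (min_right_ideals Mfib) (min_left_ideals Mfib)
               (\<lambda>L R. (rees_matrix Mfib e L R, \<one>\<^bsub>Y\<^esub>)) \<cong> M"
      using \<Phi>1 \<Phi>2 by (intro exI[of _ \<phi>] conjI \<phi>(1) rees3 bexI[OF _ \<phi>(2)]) auto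
  qed
qed

end
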